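(* Let $(B_0,\|\cdot\|_0)$ and $(B_1,\|\cdot\|_1)$ be two normed spaces with $B_1\subset B_0$ and $\|b\|_0\le\|b\|_1$ for all $b\in B_1$. Let $U\subset B_1$ be open, let $\partial_\pm\in\Omega_0$ be the almost vertical graphs corresponding to functions $\hat\partial_\pm:U\to\mathbb R$ with $1>\hat\partial_+(b)>\hat\partial_-(b)>0$ for $b\in U$, and let $$D=\{(y,b)\in[0,1]\times U:\ \hat\partial_-(b)\le y\le\hat\partial_+(b)\}.$$ For all $p=(y,b)\in D$, with $F(p)=(\tilde y,\tilde b)$, assume the map $F:D\to\mathbb R\times B_1\subset\mathbb R\times B_0$ has the following properties. (1) $F$ is jump-out-differentiable. (2) $F$ has derivatives of the following form: there exist $E\ne0$ and $0\le\kappa<1$ such that, if $DF_p(\Delta y,\Delta b)=(\Delta\tilde y,\Delta\tilde b)$, then $$\Delta\tilde y=\frac{E_p}{y}\,\Delta y+O(\|\Delta b\|_0),\qquad \|\Delta\tilde b\|_0=O\Big(\frac{1}{\tilde y^{\kappa}}|\Delta y|+\|\Delta b\|_0\Big),$$ where $1/E\le|E_p|\le E$. Let $1/4>\delta>0$, let $U_\delta\subset U$ be such that $\hat\partial_+(b)<\delta$ for all $b\in U_\delta$, and let $D_\delta\subset D$ be the set of $(y,b)\in D$ with $b\in U_\delta$. Assume further: (3) $F:D_\delta\to\mathbb R\times B_1\subset\mathbb R\times B_0$ is topologically hyperbolic for all $\delta>0$, i.e. for points of $D_\delta$: if $F(\hat\partial_+(b),b)=(\tilde y,\tilde b)$ then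 $\tilde y\le\hat\partial_-(\tilde b)$; if $F(\hat\partial_-(b),b)=(\tilde y,\tilde b)$ then $\tilde y\ge\hat\partial_+(\tilde b)$; if $F(y,b)=(\tilde y,\tilde b)$ then $\tilde b\in U_\delta$. (4) $F$ has vertical $\xi$-expansion, $\xi>0$, i.e. $\dfrac{y}{\tilde y^{\kappa}}\ge\xi$. (5) $F$ has $\eta$-dominating horizontal expansion, $\eta>0$, i.e. $\dfrac{y^2}{\tilde y^{\kappa}}\le\eta$. Then, for $\theta>0$, $\delta>0$, $\eta>0$ small enough and $\xi>0$ large enough, the invariant set $$W=\{p\in D_\delta:\ \forall n\in\mathbb N\ \ F^n(p)\in D_\delta\}$$ is an almost vertical graph of a $C^1$ function $\hat\omega:U_\delta\to\mathbb R$.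
   Context: On $\mathbb R\times B$ ($B$ a normed space with norm $\|\cdot\|$) the norm is $|(y,b)|=|y|+\|b\|$. The constants implied by $O$ are uniform. Jump-out-differentiability: let $B_1\subset B_0$ be normed spaces with $\|b\|_0\le\|b\|_1$ for $b\in B_1$, and let $V\subset B_1$ be open. A map $F:V\subset B_1\to B_1\subset B_0$ is jump-out-differentiable if for every $p\in V$ the map $F:V\subset B_1\to B_0$ is differentiable in $p$, the derivative $DF_p$ extends to a bounded operator $DF_p:B_0\to B_0$, and $DF_p$ depends continuously on $p$. In the claim the notion is applied to $F$ on $D$, with $\mathbb R\times B_1\subset\mathbb R\times B_0$ in the roles of $B_1\subset B_0$; $DF_p$ denotes the extended derivative. Cone field: $\theta>0$ is a parameter and $\kappa$ is the exponent in the claim. For $p=(y,b)\in\mathbb R\times B_0$, $C_p=\{(\Delta y,\Delta b)\in\mathbb R\times B_0:\ \theta|y|^{\kappa}\|\Delta b\|_0<|\Delta y|\}$. Almost horizontal curve: the graph $\gamma=\{(t,\hat\gamma(t))\}$ of a continuous function $\hat\gamma:[t_-,t_+]\subset[0,1]\to B_1$ such that $\hat\gamma:[t_-,t_+]\to B_0$ is continuously differentiable and, for every $p\in\gamma$, the tangent space satisfies $T_p\gamma\subset C_p$ (understood for nonzero tangent vectors). $\Gamma_0$ is the set of almost horizontal curves. Almost vertical graph: the graph $\omega=\{(\hat\omega(b),b)\}$ of a continuous function $\hat\omega:U\subset B_1\to\mathbb R$ such that, for every $\gamma\in\Gamma_0$, $\gamma\cap\omega$ is at most one point. $\Omega_0$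 is the set of almost vertical graphs. In the conclusion the domain is $U_\delta$ instead of $U$.
   Formalization: F is additionally assumed continuous as a map D → R×B_1, U_δ is assumed open, and almost vertical graphs over U (resp. U_δ) are tested only against almost horizontal curves lying over U (resp. U_δ); without the first and third the claim is false. *)

theory Defs
  imports "HOL-Analysis.Analysis"
begin

text \<open>
  The pair \<open>B\<^sub>1 \<subset> B\<^sub>0\<close> is a pair of types \<open>'b\<close>, \<open>'a\<close> of class \<open>real_normed_vector\<close> with
  an injective linear inclusion \<open>\<iota> :: 'b \<Rightarrow> 'a\<close> satisfying \<open>norm (\<iota> b) \<le> norm b\<close>.
  The library norm on a product is the Euclidean combination of the two norms. It is equivalent to
  the sum norm, and only the notions of derivative, bounded operator and continuity, which agree
  for equivalent norms, are used on products.
\<close>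

text \<open>
  The real power with \<open>0\<^sup>0 = 1\<close> (the library has \<open>0 powr 0 = 0\<close>).
\<close>

definition rpower :: "real \<Rightarrow> real \<Rightarrow> real" where
  "rpower x a = (if a = 0 then 1 else x powr a)"

text \<open>
  \<open>j\<close> is the inclusion of the smaller space and \<open>DF p\<close> is the extended derivative. The extension
  is part of the data, since it is not unique unless the smaller space is dense. The derivative is
  taken relative to \<open>V\<close> because the notion is applied to a set that is not open; for open \<open>V\<close> it
  is the usual one. \<open>DF\<close> is continuous from the topology of the smaller space to the operator norm.
\<close>

definition jump_out_differentiable_on ::
  "('d::real_normed_vector \<Rightarrow> 'c::real_normed_vector) \<Rightarrow> 'd set \<Rightarrow> ('d \<Rightarrow> 'd)
    \<Rightarrow> ('d \<Rightarrow> 'c \<Rightarrow>\<^sub>L 'c) \<Rightarrow> bool" where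
  "jump_out_differentiable_on j V F DF \<longleftrightarrow>
     (\<forall>p\<in>V. ((\<lambda>q. j (F q)) has_derivative (\<lambda>v. blinfun_apply (DF p) (j v))) (at p within V)) \<and>
     continuous_on V DF"

definition cone :: "real \<Rightarrow> real \<Rightarrow> real \<times> 'a::real_normed_vector \<Rightarrow> (real \<times> 'a) set" where
  "cone \<theta> \<kappa> p = {(dy, db). \<theta> * rpower \<bar>fst p\<bar> \<kappa> * norm db < \<bar>dy\<bar>}"

text \<open>
  The tangent space of the graph of \<open>g\<close> at \<open>(t, g t)\<close> consists of the multiples of \<open>(1, g' t)\<close>.
\<close>

definition almost_horizontal_curves ::
  "('b::real_normed_vector \<Rightarrow> 'a::real_normed_vector) \<Rightarrow> real \<Rightarrow> real \<Rightarrow> (real \<times> 'b) set set" where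
  "almost_horizontal_curves \<iota> \<theta> \<kappa> =
     {(\<lambda>t. (t, g t)) ` {tm..tp} | g tm tp.
        0 \<le> tm \<and> tm < tp \<and> tp \<le> 1 \<and> continuous_on {tm..tp} g \<and>
        (\<exists>g'. continuous_on {tm..tp} g' \<and>
           (\<forall>t\<in>{tm..tp}.
              ((\<lambda>s. \<iota> (g s)) has_vector_derivative g' t) (at t within {tm..tp}) \<and>
              (\<forall>c. c \<noteq> 0 \<longrightarrow> (c, c *\<^sub>R g' t) \<in> cone \<theta> \<kappa> (t, \<iota> (g t)))))}"

definition graph_over :: "'b set \<Rightarrow> ('b \<Rightarrow> real) \<Rightarrow> (real \<times> 'b) set" where
  "graph_over U w = (\<lambda>b. (w b, b)) ` U"

text \<open>
  A graph with domain \<open>U\<close> is tested against the almost horizontal curves that run over \<open>U\<close>.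
  A curve that leaves \<open>U\<close> joins points of the graph through a region where no data are given;
  if such curves were admitted, the two sides of a thin slit in \<open>U\<close>, on which the dynamics is
  unrelated, would have to be controlled by each other.
\<close>

definition almost_vertical ::
  "('b::real_normed_vector \<Rightarrow> 'a::real_normed_vector) \<Rightarrow> real \<Rightarrow> real \<Rightarrow> 'b set \<Rightarrow> ('b \<Rightarrow> real)
    \<Rightarrow> bool" where
  "almost_vertical \<iota> \<theta> \<kappa> U w \<longleftrightarrow>
     continuous_on U w \<and>
     (\<forall>\<gamma> \<in> almost_horizontal_curves \<iota> \<theta> \<kappa>. \<gamma> \<subseteq> UNIV \<times> U \<longrightarrow>
        (\<forall>p \<in> \<gamma> \<inter> graph_over U w. \<forall>q \<in> \<gamma> \<inter> graph_over U w. p = q))"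

definition region :: "'b set \<Rightarrow> ('b \<Rightarrow> real) \<Rightarrow> ('b \<Rightarrow> real) \<Rightarrow> (real \<times> 'b) set" where
  "region U dm dp = {(y, b). y \<in> {0..1} \<and> b \<in> U \<and> dm b \<le> y \<and> y \<le> dp b}"

text \<open>
  \<open>Ep\<close> is the coefficient \<open>E\<^sub>p\<close>, and \<open>K\<close> is the uniform constant behind both \<open>O\<close>-terms.
  The increments range over the larger space, that is, the estimates are for the extended derivative.
\<close>

definition derivative_form ::
  "real \<Rightarrow> real \<Rightarrow> real \<Rightarrow> (real \<times> 'b) set \<Rightarrow> (real \<times> 'b \<Rightarrow> real \<times> 'b)
    \<Rightarrow> (real \<times> 'b \<Rightarrow> (real \<times> 'a::real_normed_vector) \<Rightarrow>\<^sub>L (real \<times> 'a))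
    \<Rightarrow> (real \<times> 'b \<Rightarrow> real) \<Rightarrow> bool" where
  "derivative_form E \<kappa> K D F DF Ep \<longleftrightarrow>
     (\<forall>p\<in>D. 1 / E \<le> \<bar>Ep p\<bar> \<and> \<bar>Ep p\<bar> \<le> E \<and>
        (\<forall>dy db dy' db'. blinfun_apply (DF p) (dy, db) = (dy', db') \<longrightarrow>
           \<bar>dy' - Ep p / fst p * dy\<bar> \<le> K * norm db \<and>
           norm db' \<le> K * (1 / rpower (fst (F p)) \<kappa> * \<bar>dy\<bar> + norm db)))"

definition topologically_hyperbolic ::
  "('b \<Rightarrow> real) \<Rightarrow> ('b \<Rightarrow> real) \<Rightarrow> 'b set \<Rightarrow> (real \<times> 'b \<Rightarrow> real \<times> 'b) \<Rightarrow> bool" where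
  "topologically_hyperbolic dm dp U F \<longleftrightarrow>
     (\<forall>b\<in>U. \<forall>y' b'. F (dp b, b) = (y', b') \<longrightarrow> y' \<le> dm b') \<and>
     (\<forall>b\<in>U. \<forall>y' b'. F (dm b, b) = (y', b') \<longrightarrow> y' \<ge> dp b') \<and>
     (\<forall>(y, b) \<in> region U dm dp. \<forall>y' b'. F (y, b) = (y', b') \<longrightarrow> b' \<in> U)"

text \<open>
  In the next two conditions the power is meaningful for a positive first coordinate of \<open>F p\<close>.
  Where the power is \<open>0\<close> the first condition is false for \<open>\<xi> > 0\<close>, because \<open>y / 0 = 0\<close>.
\<close>

definition vertical_expansion ::
  "real \<Rightarrow> real \<Rightarrow> (real \<times> 'b) set \<Rightarrow> (real \<times> 'b \<Rightarrow> real \<times> 'b) \<Rightarrow> bool" where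
  "vertical_expansion \<kappa> \<xi> D F \<longleftrightarrow> (\<forall>p\<in>D. fst p / rpower (fst (F p)) \<kappa> \<ge> \<xi>)"

definition dominating_horizontal_expansion ::
  "real \<Rightarrow> real \<Rightarrow> (real \<times> 'b) set \<Rightarrow> (real \<times> 'b \<Rightarrow> real \<times> 'b) \<Rightarrow> bool" where
  "dominating_horizontal_expansion \<kappa> \<eta> D F \<longleftrightarrow>
     (\<forall>p\<in>D. (fst p)\<^sup>2 / rpower (fst (F p)) \<kappa> \<le> \<eta>)"

definition invariant_set :: "'c set \<Rightarrow> ('c \<Rightarrow> 'c) \<Rightarrow> 'c set" where
  "invariant_set D F = {p \<in> D. \<forall>n::nat. (F ^^ n) p \<in> D}"

definition C1_on :: "'b::real_normed_vector set \<Rightarrow> ('b \<Rightarrow> real) \<Rightarrow> bool" where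
  "C1_on U w \<longleftrightarrow>
     (\<exists>w' :: 'b \<Rightarrow> 'b \<Rightarrow>\<^sub>L real.
        (\<forall>b\<in>U. (w has_derivative blinfun_apply (w' b)) (at b)) \<and> continuous_on U w')"

end

theory Submission
  imports Defs
begin

text \<open>
  Almost horizontal curves inside the region are mapped by \<open>F\<close> to almost horizontal curves, and the
  first coordinate is stretched by a factor of at least 2. A curve that joins the two boundary graphs
  has an image that crosses the region again, so by compactness every vertical fibre carries a
  point whose orbit stays in the region; by expansion an almost horizontal curve contains at most one
  such point. Tangent covectors of the invariant set are the limits of pulled back covectors, since
  the pull-back contracts the norm weighted by \<open>y powr \<kappa>\<close>. A tangency error of relative size \<open>c\<close> at all
  points of the invariant set improves to \<open>c / 2\<close> by applying \<open>F\<close> once; therefore the error is of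
  smaller order and the invariant set is \<open>C\<^sup>1\<close>.

  The error terms have to be small relative to the norm of the larger space although \<open>F\<close> is
  differentiable only relative to the norm of the smaller one, since \<open>F\<close> is merely continuous into
  the smaller space. This is obtained from the mean value theorem and the continuity of the extended
  derivative.
\<close>

section \<open>Almost horizontal curves\<close>

text \<open>Write y and y' for the heights of a point and of its image. The horizontal part of the
  derivative grows like \<open>1 / y' powr \<kappa>\<close>; the weight
  \<open>y powr \<kappa>\<close> in the cones and in the norm of covectors is the one that cancels
  this growth at the image. What remains is a coupling of size K. It has to be beaten by the
  vertical stretching, which is at least 1 / (E y), even after the stretching is multiplied by the
  weight; since \<kappa> < 1, this is a matter of small \<delta>. Vertical expansion keeps the
  weight from growing: \<open>y' powr \<kappa> \<le> y \<le> y powr \<kappa>\<close>. The estimates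
  rest on these two facts, the first with a margin of 16.

  The spaces are not assumed to be complete. Limits are therefore taken only in vertical fibres,
  which are compact intervals, and in the space of bounded functionals, which is always
  complete.\<close>

definition horizontal ::
  "('b::real_normed_vector \<Rightarrow> 'a::real_normed_vector) \<Rightarrow> real \<Rightarrow> real \<Rightarrow> (real \<Rightarrow> 'b) \<Rightarrow> (real \<Rightarrow> 'a)
    \<Rightarrow> real \<Rightarrow> real \<Rightarrow> bool" where
  "horizontal \<iota> \<theta> \<kappa> g g' a b \<longleftrightarrow>
     0 \<le> a \<and> a < b \<and> b \<le> 1 \<and> continuous_on {a..b} g \<and> continuous_on {a..b} g' \<and>
     (\<forall>t\<in>{a..b}. ((\<lambda>s. \<iota> (g s)) has_vector_derivative g' t) (at t within {a..b}) \<and>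
        \<theta> * rpower t \<kappa> * norm (g' t) < 1)"

abbreviation trace_of :: "(real \<Rightarrow> 'b) \<Rightarrow> real \<Rightarrow> real \<Rightarrow> (real \<times> 'b) set" where
  "trace_of g a b \<equiv> (\<lambda>t. (t, g t)) ` {a..b}"

text \<open>The cone is invariant under nonzero scaling, so the single vector \<open>(1, v)\<close>
  decides.\<close>

lemma cone_multiples_iff:
  assumes "0 \<le> t"
  shows "(\<forall>c. c \<noteq> 0 \<longrightarrow> (c, c *\<^sub>R v) \<in> cone \<theta> \<kappa> (t, x)) \<longleftrightarrow> \<theta> * rpower t \<kappa> * norm v < 1"
proof -
  have "(c, c *\<^sub>R v) \<in> cone \<theta> \<kappa> (t, x) \<longleftrightarrow> \<theta> * rpower t \<kappa> * norm v < 1" if "c \<noteq> 0" for c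
  proof -
    have "(c, c *\<^sub>R v) \<in> cone \<theta> \<kappa> (t, x) \<longleftrightarrow> \<bar>c\<bar> * (\<theta> * rpower t \<kappa> * norm v) < \<bar>c\<bar> * 1"
      using assms by (simp add: cone_def mult_ac)
    then show ?thesis
      using that by (simp add: mult.assoc)
  qed
  then show ?thesis
    by (metis zero_neq_one)
qed

lemma almost_horizontal_curves_iff:
  "\<gamma> \<in> almost_horizontal_curves \<iota> \<theta> \<kappa> \<longleftrightarrow>
     (\<exists>g g' a b. horizontal \<iota> \<theta> \<kappa> g g' a b \<and> \<gamma> = trace_of g a b)"
  (is "?L \<longleftrightarrow> ?R")
proof
  assume ?L
  then obtain g a b g' where *: "\<gamma> = trace_of g a b" "0 \<le> a" "a < b" "b \<le> 1"
    "continuous_on {a..b} g" "continuous_on {a..b} g'"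
    "\<forall>t\<in>{a..b}. ((\<lambda>s. \<iota> (g s)) has_vector_derivative g' t) (at t within {a..b}) \<and>
              (\<forall>c. c \<noteq> 0 \<longrightarrow> (c, c *\<^sub>R g' t) \<in> cone \<theta> \<kappa> (t, \<iota> (g t)))"
    unfolding almost_horizontal_curves_def by blast
  then have "horizontal \<iota> \<theta> \<kappa> g g' a b"
    unfolding horizontal_def by (auto simp: cone_multiples_iff)
  then show ?R
    using * by blast
next
  assume ?R
  then obtain g g' a b where *: "horizontal \<iota> \<theta> \<kappa> g g' a b" "\<gamma> = trace_of g a b"
    by blast
  have "(\<forall>c. c \<noteq> 0 \<longrightarrow> (c, c *\<^sub>R g' t) \<in> cone \<theta> \<kappa> (t, \<iota> (g t)))" if "t \<in> {a..b}" for t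
    using * that by (subst cone_multiples_iff) (auto simp: horizontal_def)
  then show ?L
    using * unfolding almost_horizontal_curves_def horizontal_def by blast
qed

lemma horizontal_subinterval:
  assumes "horizontal \<iota> \<theta> \<kappa> g g' a b" "a \<le> c" "c < d" "d \<le> b"
  shows "horizontal \<iota> \<theta> \<kappa> g g' c d"
proof -
  have sub: "{c..d} \<subseteq> {a..b}"
    using assms by auto
  show ?thesis
    using assms sub unfolding horizontal_def
    by (meson continuous_on_subset has_vector_derivative_within_subset order_trans subsetD)
qed

text \<open>A property of a set and not of a function, because it is needed for the invariant set
  before that set is known to be a graph.\<close>

definition meets_once ::
  "('b::real_normed_vector \<Rightarrow> 'a::real_normed_vector) \<Rightarrow> real \<Rightarrow> real \<Rightarrow> 'b set \<Rightarrow> (real \<times> 'b) set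
    \<Rightarrow> bool" where
  "meets_once \<iota> \<theta> \<kappa> U S \<longleftrightarrow>
     (\<forall>g g' a b s t. horizontal \<iota> \<theta> \<kappa> g g' a b \<and> g ` {a..b} \<subseteq> U \<and> s \<in> {a..b} \<and> t \<in> {a..b} \<and>
        (s, g s) \<in> S \<and> (t, g t) \<in> S \<longrightarrow> s = t)"

lemma almost_vertical_iff:
  "almost_vertical \<iota> \<theta> \<kappa> U w \<longleftrightarrow> continuous_on U w \<and> meets_once \<iota> \<theta> \<kappa> U (graph_over U w)"
proof -
  have "(\<forall>\<gamma> \<in> almost_horizontal_curves \<iota> \<theta> \<kappa>. \<gamma> \<subseteq> UNIV \<times> U \<longrightarrow>
        (\<forall>p \<in> \<gamma> \<inter> graph_over U w. \<forall>q \<in> \<gamma> \<inter> graph_over U w. p = q))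
      \<longleftrightarrow> meets_once \<iota> \<theta> \<kappa> U (graph_over U w)" (is "?L \<longleftrightarrow> ?R")
  proof
    assume L: ?L
    show ?R
      unfolding meets_once_def
    proof (intro allI impI, elim conjE)
      fix g g' a b s t
      assume *: "horizontal \<iota> \<theta> \<kappa> g g' a b" "g ` {a..b} \<subseteq> U" "s \<in> {a..b}" "t \<in> {a..b}"
        "(s, g s) \<in> graph_over U w" "(t, g t) \<in> graph_over U w"
      then have "trace_of g a b \<in> almost_horizontal_curves \<iota> \<theta> \<kappa>" "trace_of g a b \<subseteq> UNIV \<times> U"
        by (auto simp: almost_horizontal_curves_iff)
      with L have "\<forall>p \<in> trace_of g a b \<inter> graph_over U w. \<forall>q \<in> trace_of g a b \<inter> graph_over U w. p = q"
        by metis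
      moreover have "(s, g s) \<in> trace_of g a b \<inter> graph_over U w"
        "(t, g t) \<in> trace_of g a b \<inter> graph_over U w"
        using * by simp_all
      ultimately have "(s, g s) = (t, g t)"
        by metis
      then show "s = t"
        by simp
    qed
  next
    assume R: ?R
    show ?L
    proof (intro ballI impI)
      fix \<gamma> p q
      assume "\<gamma> \<in> almost_horizontal_curves \<iota> \<theta> \<kappa>" and sub: "\<gamma> \<subseteq> UNIV \<times> U"
        and p: "p \<in> \<gamma> \<inter> graph_over U w" and q: "q \<in> \<gamma> \<inter> graph_over U w"
      then obtain g g' a b where *: "horizontal \<iota> \<theta> \<kappa> g g' a b" "\<gamma> = trace_of g a b"
        by (auto simp: almost_horizontal_curves_iff)
      obtain s t where st: "s \<in> {a..b}" "t \<in> {a..b}" "p = (s, g s)" "q = (t, g t)"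
        using p q *(2) by auto
      have "g ` {a..b} \<subseteq> U"
        using sub *(2) by auto
      then have "s = t"
        using R[unfolded meets_once_def, rule_format, of g g' a b s t] * st p q by simp
      then show "p = q"
        using st by simp
    qed
  qed
  then show ?thesis
    by (simp add: almost_vertical_def)
qed

lemma almost_vertical_subset:
  assumes "almost_vertical \<iota> \<theta> \<kappa> U w" "V \<subseteq> U"
  shows "almost_vertical \<iota> \<theta> \<kappa> V w"
  using assms unfolding almost_vertical_iff meets_once_def graph_over_def
  by (blast intro: continuous_on_subset)

text \<open>Tested against the straight segment through the two points, which lies over the convex set
  \<open>C\<close>.\<close>

lemma meets_once_lipschitz:
  fixes \<iota> :: "'b::real_normed_vector \<Rightarrow> 'a::real_normed_vector"
  assumes lin: "bounded_linear \<iota>" and "0 < \<kappa>" "0 < \<theta>"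
    and mo: "meets_once \<iota> \<theta> \<kappa> U S" and "convex C" "C \<subseteq> U"
    and p: "(y, b) \<in> S" "b \<in> C" "0 \<le> y" "y \<le> 1"
    and q: "(z, c) \<in> S" "c \<in> C" "0 \<le> z" "z \<le> 1"
  shows "\<bar>y - z\<bar> \<le> \<theta> * max y z powr \<kappa> * norm (\<iota> b - \<iota> c)"
proof -
  interpret bounded_linear \<iota> by fact
  have *: "z - y \<le> \<theta> * z powr \<kappa> * norm (\<iota> b - \<iota> c)"
    if "y < z" and p: "(y, b) \<in> S" "b \<in> C" "0 \<le> y" "y \<le> 1"
    and q: "(z, c) \<in> S" "c \<in> C" "0 \<le> z" "z \<le> 1" for y z b c
  proof (rule ccontr)
    assume neg: "\<not> ?thesis"
    \<comment> \<open>The segment from \<open>(y, b)\<close> to \<open>(z, c)\<close>, parametrised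
      by height. Its slope \<open>v\<close> is constant, so the cone condition is most restrictive
      at the upper end \<open>z\<close>, where it is the negated inequality.\<close>
    define g where "g t = b + ((t - y) / (z - y)) *\<^sub>R (c - b)" for t
    define v where "v = (1 / (z - y)) *\<^sub>R (\<iota> c - \<iota> b)"
    have "horizontal \<iota> \<theta> \<kappa> g (\<lambda>_. v) y z"
      unfolding horizontal_def
    proof (intro conjI ballI)
      show "continuous_on {y..z} g"
        unfolding g_def using \<open>y < z\<close> by (intro continuous_intros) auto
      fix t assume t: "t \<in> {y..z}"
      have "(\<lambda>s. \<iota> (g s)) = (\<lambda>s. \<iota> b + ((s - y) / (z - y)) *\<^sub>R (\<iota> c - \<iota> b))"
        by (simp add: g_def add diff scaleR)
      then show "((\<lambda>s. \<iota> (g s)) has_vector_derivative v) (at t within {y..z})"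
        unfolding v_def using \<open>y < z\<close>
        by (auto intro!: derivative_eq_intros simp: has_vector_derivative_def divide_simps)
      have nv: "norm v = norm (\<iota> b - \<iota> c) / (z - y)"
        using \<open>y < z\<close> by (simp add: v_def norm_minus_commute divide_simps)
      have "t powr \<kappa> \<le> z powr \<kappa>"
        using t p \<open>0 < \<kappa>\<close> by (intro powr_mono2) auto
      then have "\<theta> * t powr \<kappa> * norm (\<iota> b - \<iota> c) \<le> \<theta> * z powr \<kappa> * norm (\<iota> b - \<iota> c)"
        using \<open>0 < \<theta>\<close> by (intro mult_right_mono mult_left_mono) auto
      then show "\<theta> * rpower t \<kappa> * norm v < 1"
        using neg \<open>y < z\<close> \<open>0 < \<kappa>\<close> by (simp add: nv rpower_def divide_simps)
    qed (use p q \<open>y < z\<close> in auto)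
    moreover have "g ` {y..z} \<subseteq> U"
    proof -
      have "g t \<in> C" if "t \<in> {y..z}" for t
      proof -
        have "g t = (1 - (t - y) / (z - y)) *\<^sub>R b + ((t - y) / (z - y)) *\<^sub>R c"
          by (simp add: g_def algebra_simps)
        moreover have "0 \<le> (t - y) / (z - y)" "(t - y) / (z - y) \<le> 1"
          using that \<open>y < z\<close> by (auto simp: divide_simps)
        ultimately show ?thesis
          using \<open>convex C\<close> p q by (simp add: convexD)
      qed
      then show ?thesis
        using \<open>C \<subseteq> U\<close> by blast
    qed
    moreover have "g y = b" "g z = c"
      using \<open>y < z\<close> by (auto simp: g_def)
    ultimately have "y = z"
      using mo p q \<open>y < z\<close> unfolding meets_once_def by (metis atLeastAtMost_iff less_eq_real_def)
    then show False
      using \<open>y < z\<close> by simp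
  qed
  consider "y < z" | "z < y" | "y = z"
    by linarith
  then show ?thesis
  proof cases
    case 1 then show ?thesis using *[of y z b c] p q by (simp add: max_def)
  next
    case 2 then show ?thesis using *[of z y c b] p q by (simp add: max_def norm_minus_commute)
  next
    case 3 then show ?thesis using \<open>0 < \<theta>\<close> by simp
  qed
qed

section \<open>Differentiability relative to the weak norm\<close>

text \<open>A mean value estimate. The direction of the segment enters the derivative only through
  \<open>j\<close>, so the error is measured by the weak length of the segment although
  \<open>F\<close> is differentiable relative to the strong norm.\<close>

lemma segment_derivative_bound:
  fixes j :: "'d::real_normed_vector \<Rightarrow> 'c::real_normed_vector" and DF :: "'d \<Rightarrow> 'c \<Rightarrow>\<^sub>L 'c"
  assumes "bounded_linear j"
    and der: "\<And>p. p \<in> S \<Longrightarrow> ((\<lambda>q. j (F q)) has_derivative (\<lambda>v. DF p (j v))) (at p within S)"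
    and seg: "closed_segment p q \<subseteq> S"
    and bound: "\<And>x. x \<in> closed_segment p q \<Longrightarrow> norm (DF x - L) \<le> e"
  shows "norm (j (F q) - j (F p) - L (j (q - p))) \<le> e * norm (j (q - p))"
proof -
  define v where "v = j (q - p)"
  define c where "c s = p + s *\<^sub>R (q - p)" for s :: real
  define \<psi> where "\<psi> s = j (F (c s)) - s *\<^sub>R L v" for s
  have cS: "c s \<in> closed_segment p q" if "s \<in> {0..1}" for s
    using that by (force simp: c_def closed_segment_def algebra_simps)
  have c': "(c has_vector_derivative (q - p)) (at s within {0..1})" for s
    unfolding c_def by (auto intro!: derivative_eq_intros simp: has_vector_derivative_def)
  have "((\<lambda>q. j (F q)) \<circ> c has_vector_derivative DF (c s) v) (at s within {0..1})"
    if "s \<in> {0..1}" for s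
    unfolding v_def
  proof (rule vector_derivative_diff_chain_within[OF c'])
    show "((\<lambda>q. j (F q)) has_derivative (\<lambda>v. DF (c s) (j v))) (at (c s) within c ` {0..1})"
      using cS seg that by (blast intro: has_derivative_subset der)
  qed
  then have "(\<psi> has_derivative (\<lambda>h. h *\<^sub>R (DF (c s) v - L v))) (at s within {0..1})"
    if "s \<in> {0..1}" for s
    using that unfolding \<psi>_def has_vector_derivative_def o_def
    by (auto intro!: derivative_eq_intros simp: algebra_simps)
  moreover have "onorm (\<lambda>h. h *\<^sub>R (DF (c s) v - L v)) \<le> e * norm v" if "s \<in> {0..1}" for s
  proof (rule onorm_bound)
    have e: "norm (DF (c s) - L) \<le> e"
      by (rule bound[OF cS[OF that]])
    have *: "norm (DF (c s) v - L v) \<le> e * norm v"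
      using norm_blinfun[of "DF (c s) - L" v] mult_right_mono[OF e norm_ge_zero[of v]]
      by (simp add: blinfun.diff_left)
    then show "norm (h *\<^sub>R (DF (c s) v - L v)) \<le> e * norm v * norm h" for h
      using mult_left_mono[OF *, of "\<bar>h\<bar>"] by (simp add: mult_ac)
    show "0 \<le> e * norm v"
      using * norm_ge_zero order_trans by blast
  qed
  ultimately have "norm (\<psi> 1 - \<psi> 0) \<le> e * norm v * norm (1 - 0 :: real)"
    by (intro differentiable_bound[of "{0..1}"]) auto
  then show ?thesis
    by (simp add: \<psi>_def c_def v_def algebra_simps)
qed

abbreviation incl :: "('b \<Rightarrow> 'a) \<Rightarrow> real \<times> 'b \<Rightarrow> real \<times> 'a" where
  "incl \<iota> \<equiv> (\<lambda>(y, b). (y, \<iota> b))"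

lemma bounded_linear_incl:
  assumes "bounded_linear \<iota>"
  shows "bounded_linear (incl \<iota>)"
proof -
  have "bounded_linear (\<lambda>p. (fst p, \<iota> (snd p)))"
    using assms by (intro bounded_linear_Pair bounded_linear_fst bounded_linear_compose[OF _ bounded_linear_snd])
  then show ?thesis
    by (simp add: case_prod_beta')
qed

text \<open>The two points are joined inside \<open>S\<close> by going off the boundary graph of \<open>h\<close>, along a straight
  segment, and back. The length of this path in the weak norm is comparable with the weak distance of
  the points, and this gives an error term that is small relative to the weak norm.\<close>

lemma weak_derivative_one_sided:
  fixes \<iota> :: "'b::real_normed_vector \<Rightarrow> 'a::real_normed_vector"
    and DF :: "real \<times> 'b \<Rightarrow> (real \<times> 'a) \<Rightarrow>\<^sub>L (real \<times> 'a)"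
  assumes lin: "bounded_linear \<iota>" and \<iota>_le: "\<And>b. norm (\<iota> b) \<le> norm b"
    and der: "\<And>p. p \<in> S \<Longrightarrow>
      ((\<lambda>q. incl \<iota> (F q)) has_derivative (\<lambda>v. DF p (incl \<iota> v))) (at p within S)"
    and cont: "continuous_on S DF" and pS: "(y, b) \<in> S"
    and s: "\<bar>s\<bar> = 1" and r: "0 < r"
    and lip: "\<And>b' c. b' \<in> ball b r \<Longrightarrow> c \<in> ball b r \<Longrightarrow> \<bar>h b' - h c\<bar> \<le> norm (\<iota> b' - \<iota> c)"
    and side: "\<And>z c. z \<in> ball y r \<Longrightarrow> c \<in> ball b r \<Longrightarrow> (z, c) \<in> S \<longleftrightarrow> 0 \<le> s * (z - h c)"
    and e: "0 < e"
  shows "\<exists>d>0. \<forall>q\<in>S. dist q (y, b) < d \<longrightarrow>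
    norm (incl \<iota> (F q) - incl \<iota> (F (y, b)) - DF (y, b) (incl \<iota> (q - (y, b))))
      \<le> e * norm (incl \<iota> (q - (y, b)))"
proof -
  interpret \<iota>: bounded_linear \<iota> by fact
  interpret J: bounded_linear "incl \<iota>" by (rule bounded_linear_incl[OF lin])
  define L where "L = DF (y, b)"
  obtain d1 where d1: "0 < d1" "\<And>x. x \<in> S \<Longrightarrow> dist x (y, b) < d1 \<Longrightarrow> norm (DF x - L) \<le> e / 3"
    using cont[unfolded continuous_on_iff, rule_format, OF pS, of "e / 3"] e
    unfolding L_def dist_norm by (auto intro: less_imp_le)
  \<comment> \<open>The vertical legs of the path are shorter than \<open>d\<close>, so the path
    stays within \<open>2 * d\<close> of \<open>y\<close> and within \<open>d\<close> of
    \<open>b\<close>; the factor 3 covers the sum.\<close>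
  define d where "d = min r d1 / 3"
  have d: "0 < d" "3 * d \<le> r" "3 * d \<le> d1"
    using r d1 by (auto simp: d_def)
  have near: "norm (DF (x, w) - L) \<le> e / 3 \<and> (x, w) \<in> S"
    if "\<bar>x - y\<bar> < 2 * d" "norm (w - b) < d" "0 \<le> s * (x - h w)" for x w
  proof -
    have "(x, w) \<in> S"
      using side[of x w] that d by (auto simp: dist_real_def dist_norm norm_minus_commute)
    moreover have "dist (x, w) (y, b) < d1"
      using norm_Pair_le[of "x - y" "w - b"] that d by (simp add: dist_norm)
    ultimately show ?thesis
      using d1 by blast
  qed
  have seg: "norm (incl \<iota> (F q) - incl \<iota> (F p) - L (incl \<iota> (q - p))) \<le> e / 3 * norm (incl \<iota> (q - p))"
    if "\<And>x w. (x, w) \<in> closed_segment p q \<Longrightarrow>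
      \<bar>x - y\<bar> < 2 * d \<and> norm (w - b) < d \<and> 0 \<le> s * (x - h w)" for p q
    using that near by (intro segment_derivative_bound[OF bounded_linear_incl[OF lin] der]) auto
  show ?thesis
  proof (intro exI[of _ d] conjI ballI impI)
    fix q assume q: "q \<in> S" "dist q (y, b) < d"
    obtain z c where zc: "q = (z, c)"
      by (cases q)
    have z: "\<bar>z - y\<bar> < d" and c: "norm (c - b) < d"
      using q zc norm_fst_le[of "z - y" "c - b"] norm_snd_le[of "c - b" "z - y"]
      by (auto simp: dist_norm)
    \<comment> \<open>The height of the detour, in the direction \<open>s\<close> that points into
      \<open>S\<close>. Since \<open>h\<close> is 1-Lipschitz for the weak norm, a shift by the weak
      distance of the base points clears the graph along the whole slanted segment.\<close>
    define \<rho> where "\<rho> = norm (\<iota> c - \<iota> b)"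
    have \<rho>: "0 \<le> \<rho>" "\<rho> < d"
      using \<iota>_le[of "c - b"] c by (auto simp: \<rho>_def \<iota>.diff)
    have pb: "0 \<le> s * (y - h b)"
      using side[of y b] pS r by simp
    have qc: "0 \<le> s * (z - h c)"
      using side[of z c] q zc z c d by (auto simp: dist_real_def dist_norm norm_minus_commute)
    have ss: "s * s = 1"
      using s by (metis abs_mult_self_eq mult_1)
    have vertical: "\<bar>x - y\<bar> < 2 * d \<and> norm (w - b) < d \<and> 0 \<le> s * (x - h w)"
      if xw: "(x, w) \<in> closed_segment (y', b') (y' + s * \<rho>, b')" and
        y': "\<bar>y' - y\<bar> < d" "norm (b' - b) < d" "0 \<le> s * (y' - h b')" for x w y' b'
    proof -
      obtain u where u: "0 \<le> u" "u \<le> 1" "x = y' + u * (s * \<rho>)" "w = b'"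
        using xw by (auto simp: closed_segment_def algebra_simps simp flip: scaleR_add_left)
      have u\<rho>: "0 \<le> u * \<rho>" "u * \<rho> \<le> \<rho>"
        using u \<rho> by (auto simp: mult_left_le_one_le)
      have "\<bar>u * (s * \<rho>)\<bar> = u * \<rho>"
        using s u \<rho> by (simp add: abs_mult)
      then have "\<bar>x - y\<bar> < 2 * d"
        using u y' u\<rho> \<rho> by linarith
      moreover have "s * (x - h w) = s * (y' - h b') + (s * s) * (u * \<rho>)"
        using u by (simp add: algebra_simps)
      ultimately show ?thesis
        using u y' u\<rho> ss by simp
    qed
    have slanted: "\<bar>x - y\<bar> < 2 * d \<and> norm (w - b) < d \<and> 0 \<le> s * (x - h w)"
      if xw: "(x, w) \<in> closed_segment (y + s * \<rho>, b) (z + s * \<rho>, c)" for x w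
    proof -
      obtain u where u: "0 \<le> u" "u \<le> 1" "x = y + u * (z - y) + s * \<rho>" "w = b + u *\<^sub>R (c - b)"
        using xw by (auto simp: closed_segment_def algebra_simps simp flip: scaleR_add_left)
      have uz: "\<bar>u * (z - y)\<bar> \<le> \<bar>z - y\<bar>" and uc: "norm (u *\<^sub>R (c - b)) \<le> norm (c - b)"
        using u by (auto simp: abs_mult mult_left_le_one_le)
      have s\<rho>: "\<bar>s * \<rho>\<bar> = \<rho>"
        using s \<rho> by (simp add: abs_mult)
      have w: "norm (w - b) < d"
        using u uc c by simp
      have balls: "w \<in> ball b r" "b \<in> ball b r" "c \<in> ball b r"
        using w c d by (auto simp: dist_norm norm_minus_commute)
      have "\<iota> b - \<iota> w = (- u) *\<^sub>R (\<iota> c - \<iota> b)"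
        by (simp add: u \<iota>.add \<iota>.scaleR \<iota>.diff)
      then have "norm (\<iota> b - \<iota> w) = u * \<rho>"
        using u by (simp add: \<rho>_def)
      then have hb: "\<bar>h b - h w\<bar> \<le> \<rho>"
        using lip[OF balls(2,1)] u \<rho> mult_left_le_one_le[of \<rho> u] by linarith
      have "\<iota> c - \<iota> w = (1 - u) *\<^sub>R (\<iota> c - \<iota> b)"
        by (simp add: u \<iota>.add \<iota>.scaleR \<iota>.diff algebra_simps)
      then have "norm (\<iota> c - \<iota> w) = (1 - u) * \<rho>"
        using u by (simp add: \<rho>_def)
      then have hc: "\<bar>h c - h w\<bar> \<le> \<rho>"
        using lip[OF balls(3,1)] u \<rho> mult_left_le_one_le[of \<rho> "1 - u"] by linarith
      \<comment> \<open>A convex combination of the nonnegative heights over \<open>h\<close> at the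
        two ends, plus the shift. The two Lipschitz terms together lose at most
        \<open>\<rho>\<close>, which is what the shift provides.\<close>
      have "s * (x - h w) = (1 - u) * (s * (y - h b)) + u * (s * (z - h c)) + (s * s) * \<rho>
          + (1 - u) * (s * (h b - h w)) + u * (s * (h c - h w))"
        by (simp add: u algebra_simps)
      moreover have "s = 1 \<or> s = - 1"
        using s by linarith
      then have "- \<rho> \<le> s * (h b - h w)" "- \<rho> \<le> s * (h c - h w)"
        using hb hc by auto
      then have "(1 - u) * (- \<rho>) \<le> (1 - u) * (s * (h b - h w))" "u * (- \<rho>) \<le> u * (s * (h c - h w))"
        using u(1,2) by (intro mult_left_mono; linarith)+
      moreover have "0 \<le> (1 - u) * (s * (y - h b))" "0 \<le> u * (s * (z - h c))"
        using u pb qc by auto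
      ultimately have "0 \<le> s * (x - h w)"
        using ss by (simp add: algebra_simps)
      moreover have "\<bar>x - y\<bar> < 2 * d"
        using u(3) uz z s\<rho> \<rho> by linarith
      ultimately show ?thesis
        using w by simp
    qed
    let ?j = "incl \<iota>" and ?p = "(y, b)" and ?p2 = "(y + s * \<rho>, b)" and ?p3 = "(z + s * \<rho>, c)"
    define R where "R u v = ?j (F v) - ?j (F u) - L (?j (v - u))" for u v
    have "norm (R ?p ?p2) \<le> e / 3 * norm (?j (?p2 - ?p))"
      unfolding R_def by (rule seg, rule vertical) (use pb d in auto)
    also have "norm (?j (?p2 - ?p)) = \<rho>"
      using s \<rho> by (auto simp: norm_Pair abs_mult \<iota>.zero)
    finally have 1: "norm (R ?p ?p2) \<le> e / 3 * \<rho>" .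
    have "norm (R ?p3 q) \<le> e / 3 * norm (?j (q - ?p3))"
      unfolding R_def by (rule seg, rule vertical[of _ _ z c])
        (use qc z c zc in \<open>auto simp: closed_segment_commute\<close>)
    also have "norm (?j (q - ?p3)) = \<rho>"
      using s \<rho> by (auto simp: zc norm_Pair abs_mult \<iota>.zero)
    finally have 2: "norm (R ?p3 q) \<le> e / 3 * \<rho>" .
    have "norm (R ?p2 ?p3) \<le> e / 3 * norm (?j (?p3 - ?p2))"
      unfolding R_def by (rule seg, rule slanted)
    moreover have "?p3 - ?p2 = q - ?p"
      by (simp add: zc)
    ultimately have 3: "norm (R ?p2 ?p3) \<le> e / 3 * norm (?j (q - ?p))"
      by metis
    have "\<rho> \<le> norm (?j (q - ?p))"
      using norm_snd_le[of "\<iota> c - \<iota> b" "z - y"] by (simp add: zc \<rho>_def \<iota>.diff)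
    then have 4: "e / 3 * \<rho> \<le> e / 3 * norm (?j (q - ?p))"
      using e by simp
    \<comment> \<open>The increments of the three legs add up to \<open>q - ?p\<close>, so the three
      errors, each at most \<open>e / 3\<close> times the weak distance, add up as well.\<close>
    have "L (?j (q - ?p)) = L (?j ((?p2 - ?p) + (q - ?p3) + (?p3 - ?p2)))"
      by (simp add: zc)
    also have "\<dots> = L (?j (?p2 - ?p)) + L (?j (q - ?p3)) + L (?j (?p3 - ?p2))"
      by (simp only: J.add blinfun.add_right)
    finally have "R ?p q = R ?p ?p2 + R ?p3 q + R ?p2 ?p3"
      unfolding R_def by simp
    then have "norm (R ?p q) \<le> norm (R ?p ?p2) + norm (R ?p3 q) + norm (R ?p2 ?p3)"
      by (metis norm_triangle_ineq norm_triangle_le add_right_mono)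
    then have "norm (R ?p q) \<le> e * norm (?j (q - ?p))"
      using 1 2 3 4 by (simp add: field_simps)
    then show "norm (?j (F q) - ?j (F ?p) - DF ?p (?j (q - ?p))) \<le> e * norm (?j (q - ?p))"
      unfolding L_def R_def .
  qed (use d in simp)
qed

section \<open>Invariance of the cone field\<close>

text \<open>The setting for one fixed \<delta>, with \<open>V\<close> in the role of
  \<open>Ud \<delta>\<close>. \<open>small\<close> expresses that \<delta> is small for the given
  \<theta>; \<open>target\<close> is vertical expansion together with the sign of the image height.
  The case \<open>\<kappa> = 0\<close> is absent: vertical expansion with \<xi> > 1 then fails at
  every point below height 1.\<close>

locale expanding_region =
  fixes \<iota> :: "'b::real_normed_vector \<Rightarrow> 'a::real_normed_vector"
    and E \<kappa> K \<theta> :: real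
    and V :: "'b set" and dm dp :: "'b \<Rightarrow> real"
    and F :: "real \<times> 'b \<Rightarrow> real \<times> 'b"
    and DF :: "real \<times> 'b \<Rightarrow> (real \<times> 'a) \<Rightarrow>\<^sub>L (real \<times> 'a)"
    and Ep :: "real \<times> 'b \<Rightarrow> real"
  assumes linear: "linear \<iota>" and norm_le: "norm (\<iota> b) \<le> norm b"
    and E_pos: "0 < E" and K_ge: "1 \<le> K" and \<kappa>: "0 < \<kappa>" "\<kappa> < 1" and \<theta>: "0 < \<theta>" "\<theta> < 1"
    and open_V: "open V"
    and vertical_dm: "almost_vertical \<iota> \<theta> \<kappa> V dm"
    and vertical_dp: "almost_vertical \<iota> \<theta> \<kappa> V dp"
    and order: "b \<in> V \<Longrightarrow> 0 < dm b \<and> dm b < dp b \<and> dp b < 1"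
    and continuous_F: "continuous_on (region V dm dp) F"
    and jump_out: "jump_out_differentiable_on (incl \<iota>) (region V dm dp) F DF"
    and form: "derivative_form E \<kappa> K (region V dm dp) F DF Ep"
    and hyperbolic: "topologically_hyperbolic dm dp V F"
    and small: "p \<in> region V dm dp \<Longrightarrow> 16 * E * K * fst p \<le> \<theta> * fst p powr \<kappa>"
    and target: "p \<in> region V dm dp \<Longrightarrow> 0 < fst (F p) \<and> fst (F p) powr \<kappa> \<le> fst p"
begin

abbreviation "D \<equiv> region V dm dp"

lemma bounded_linear_\<iota>: "bounded_linear \<iota>"
  using linear norm_le by (intro bounded_linear_intro[where K=1]) (auto simp: linear_iff)

sublocale \<iota>: bounded_linear \<iota>
  by (rule bounded_linear_\<iota>)

sublocale J: bounded_linear "incl \<iota>"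
  by (rule bounded_linear_incl[OF bounded_linear_\<iota>])

lemma region_iff: "(y, b) \<in> D \<longleftrightarrow> b \<in> V \<and> dm b \<le> y \<and> y \<le> dp b"
  using order[of b] by (auto simp: region_def)

lemma region_bounds:
  assumes "p \<in> D"
  shows "0 < fst p" "fst p < 1" "snd p \<in> V"
  using assms order[of "snd p"] by (cases p; auto simp: region_iff)+

lemma snd_F_in: "p \<in> D \<Longrightarrow> snd (F p) \<in> V"
  using hyperbolic unfolding topologically_hyperbolic_def by (cases p, cases "F p") fastforce

lemma fst_F_bounds:
  assumes "p \<in> D"
  shows "0 < fst (F p)" "fst (F p) < 1"
proof -
  show "0 < fst (F p)"
    using target[OF assms] by simp
  have "fst (F p) powr \<kappa> < 1"
    using target[OF assms] region_bounds[OF assms] by simp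
  then show "fst (F p) < 1"
    using ge_one_powr_ge_zero[of "fst (F p)" \<kappa>] \<kappa> by linarith
qed

lemma fst_le_powr: "p \<in> D \<Longrightarrow> fst p \<le> fst p powr \<kappa>"
  using powr_mono'[of \<kappa> 1 "fst p"] region_bounds[of p] \<kappa> by simp

text \<open>With \<theta> < 1 and heights at most 1 the Lipschitz constant drops to 1, the value
  that the detour in \<open>weak_derivative_one_sided\<close> requires of the boundary
  graphs.\<close>

lemma meets_once_lipschitz_1:
  assumes "meets_once \<iota> \<theta> \<kappa> V S" "ball b r \<subseteq> V" "(y, b') \<in> S" "(z, c) \<in> S"
    "b' \<in> ball b r" "c \<in> ball b r" "0 \<le> y" "y \<le> 1" "0 \<le> z" "z \<le> 1"
  shows "\<bar>y - z\<bar> \<le> norm (\<iota> b' - \<iota> c)"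
proof -
  have "\<bar>y - z\<bar> \<le> \<theta> * max y z powr \<kappa> * norm (\<iota> b' - \<iota> c)"
    using assms \<kappa> \<theta> by (intro meets_once_lipschitz[OF bounded_linear_\<iota>, of \<kappa> \<theta> V S "ball b r"]) auto
  moreover have "max y z powr \<kappa> \<le> 1"
    using assms \<kappa> by (intro powr_le1) auto
  then have "\<theta> * max y z powr \<kappa> \<le> 1"
    using \<theta> by (simp add: mult_le_one)
  then have "\<theta> * max y z powr \<kappa> * norm (\<iota> b' - \<iota> c) \<le> norm (\<iota> b' - \<iota> c)"
    by (simp add: mult_left_le_one_le \<theta> less_imp_le)
  ultimately show ?thesis
    by linarith
qed

lemma boundary_lipschitz:
  assumes "almost_vertical \<iota> \<theta> \<kappa> V w" "\<And>b. b \<in> V \<Longrightarrow> 0 \<le> w b \<and> w b \<le> 1" "ball b r \<subseteq> V"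
    "b' \<in> ball b r" "c \<in> ball b r"
  shows "\<bar>w b' - w c\<bar> \<le> norm (\<iota> b' - \<iota> c)"
proof (rule meets_once_lipschitz_1)
  show "meets_once \<iota> \<theta> \<kappa> V (graph_over V w)"
    using assms by (simp add: almost_vertical_iff)
  show "(w b', b') \<in> graph_over V w" "(w c, c) \<in> graph_over V w"
    using assms by (auto simp: graph_over_def)
  show "0 \<le> w b'" "w b' \<le> 1" "0 \<le> w c" "w c \<le> 1"
    using assms by (meson subsetD)+
qed (use assms in auto)

lemma local_bound:
  assumes "continuous_on V w" "b \<in> V" "0 < e"
  obtains r where "0 < r" "r \<le> e" "ball b r \<subseteq> V" "\<And>c. c \<in> ball b r \<Longrightarrow> \<bar>w c - w b\<bar> < e"
proof -
  obtain r1 where r1: "0 < r1" "ball b r1 \<subseteq> V"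
    using open_V assms(2) open_contains_ball by blast
  obtain r2 where r2: "0 < r2" "\<And>c. c \<in> V \<Longrightarrow> dist c b < r2 \<Longrightarrow> \<bar>w c - w b\<bar> < e"
    using assms unfolding continuous_on_iff dist_real_def by blast
  show ?thesis
    by (rule that[of "min e (min r1 r2)"]) (use r1 r2 assms in \<open>auto simp: dist_commute subset_iff\<close>)
qed

text \<open>Since \<open>dm < dp\<close>, each point of \<open>D\<close> is off at least one
  boundary graph; near it \<open>D\<close> is one side of the other graph.\<close>

lemma weak_derivative:
  assumes "p \<in> D" "0 < e"
  shows "\<exists>d>0. \<forall>q\<in>D. dist q p < d \<longrightarrow>
    norm (incl \<iota> (F q) - incl \<iota> (F p) - DF p (incl \<iota> (q - p))) \<le> e * norm (incl \<iota> (q - p))"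
proof -
  obtain y b where p: "p = (y, b)"
    by (cases p)
  have b: "b \<in> V" "dm b \<le> y" "y \<le> dp b"
    using assms(1) by (auto simp: p region_iff)
  have der: "\<And>p. p \<in> D \<Longrightarrow> ((\<lambda>q. incl \<iota> (F q)) has_derivative (\<lambda>v. DF p (incl \<iota> v))) (at p within D)"
    and cont: "continuous_on D DF"
    using jump_out unfolding jump_out_differentiable_on_def by auto
  have dm: "continuous_on V dm" and dp: "continuous_on V dp"
    using vertical_dm vertical_dp by (auto simp: almost_vertical_iff)
  consider "dm b < y" | "y < dp b"
    using b order[of b] by linarith
  then show ?thesis
  proof cases
    case 1
    \<comment> \<open>Half of the gap for \<open>z\<close> and half for \<open>dm c\<close>: they
      cannot meet, so only \<open>dp\<close> bounds \<open>D\<close> near the point.\<close>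
    obtain r where r: "0 < r" "r \<le> (y - dm b) / 2" "ball b r \<subseteq> V"
      "\<And>c. c \<in> ball b r \<Longrightarrow> \<bar>dm c - dm b\<bar> < (y - dm b) / 2"
      using local_bound[OF dm b(1), of "(y - dm b) / 2"] 1 by auto
    show ?thesis
      unfolding p
    proof (rule weak_derivative_one_sided[OF bounded_linear_\<iota> norm_le der cont])
      show "(y, b) \<in> D" "\<bar>- 1 :: real\<bar> = 1" "0 < r" "0 < e"
        using assms r by (auto simp: p)
      show "\<bar>dp b' - dp c\<bar> \<le> norm (\<iota> b' - \<iota> c)" if "b' \<in> ball b r" "c \<in> ball b r" for b' c
        using order by (intro boundary_lipschitz[OF vertical_dp _ r(3) that]) (auto intro: less_imp_le less_trans)
      show "(z, c) \<in> D \<longleftrightarrow> 0 \<le> - 1 * (z - dp c)" if "z \<in> ball y r" "c \<in> ball b r" for z c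
      proof -
        have "\<bar>y - z\<bar> < r"
          using that(1) by (simp add: dist_real_def)
        then have "dm c < z"
          using r(2) r(4)[OF that(2)] unfolding abs_less_iff by (simp add: field_simps)
        then show ?thesis
          using that r(3) by (auto simp: region_iff)
      qed
    qed
  next
    case 2
    obtain r where r: "0 < r" "r \<le> (dp b - y) / 2" "ball b r \<subseteq> V"
      "\<And>c. c \<in> ball b r \<Longrightarrow> \<bar>dp c - dp b\<bar> < (dp b - y) / 2"
      using local_bound[OF dp b(1), of "(dp b - y) / 2"] 2 by auto
    show ?thesis
      unfolding p
    proof (rule weak_derivative_one_sided[OF bounded_linear_\<iota> norm_le der cont])
      show "(y, b) \<in> D" "\<bar>1 :: real\<bar> = 1" "0 < r" "0 < e"
        using assms r by (auto simp: p)
      show "\<bar>dm b' - dm c\<bar> \<le> norm (\<iota> b' - \<iota> c)" if "b' \<in> ball b r" "c \<in> ball b r" for b' c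
        using order by (intro boundary_lipschitz[OF vertical_dm _ r(3) that])
          (auto intro: less_imp_le less_trans)
      show "(z, c) \<in> D \<longleftrightarrow> 0 \<le> 1 * (z - dm c)" if "z \<in> ball y r" "c \<in> ball b r" for z c
      proof -
        have "\<bar>y - z\<bar> < r"
          using that(1) by (simp add: dist_real_def)
        then have "z < dp c"
          using r(2) r(4)[OF that(2)] unfolding abs_less_iff by (simp add: field_simps)
        then show ?thesis
          using that r(3) by (auto simp: region_iff)
      qed
    qed
  qed
qed

lemma derivative_bounds:
  assumes "p \<in> D"
  shows "1 / (E * fst p) \<le> \<bar>Ep p / fst p\<bar>"
    and "\<bar>fst (DF p (a, v)) - Ep p / fst p * a\<bar> \<le> K * norm v"
    and "norm (snd (DF p (a, v))) \<le> K * (\<bar>a\<bar> / fst (F p) powr \<kappa> + norm v)"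
proof -
  have *: "1 / E \<le> \<bar>Ep p\<bar>" "\<bar>fst (DF p (a, v)) - Ep p / fst p * a\<bar> \<le> K * norm v"
    "norm (snd (DF p (a, v))) \<le> K * (1 / rpower (fst (F p)) \<kappa> * \<bar>a\<bar> + norm v)"
    using form assms unfolding derivative_form_def by (metis prod.collapse)+
  then show "\<bar>fst (DF p (a, v)) - Ep p / fst p * a\<bar> \<le> K * norm v"
    "norm (snd (DF p (a, v))) \<le> K * (\<bar>a\<bar> / fst (F p) powr \<kappa> + norm v)"
    using \<kappa> by (auto simp: rpower_def)
  have "1 / E / fst p \<le> \<bar>Ep p\<bar> / fst p"
    using * region_bounds[OF assms] by (intro divide_right_mono) auto
  then show "1 / (E * fst p) \<le> \<bar>Ep p / fst p\<bar>"
    using region_bounds[OF assms] by simp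
qed

text \<open>The weight \<open>\<theta> * fst p powr \<kappa>\<close> is at most 1, so the stretching
  beats \<open>K\<close> both with and without it. In \<open>cone_invariant\<close> the weighted
  form absorbs the coupling to the horizontal component, the plain one the remaining
  constants.\<close>

lemma expansion_bound:
  assumes "p \<in> D"
  shows "16 * K \<le> 1 / (E * fst p)" "K \<le> 1 / (E * fst p) * (\<theta> * fst p powr \<kappa>) / 16"
proof -
  have pos: "0 < E * fst p"
    using E_pos region_bounds[OF assms] by simp
  have "\<theta> * fst p powr \<kappa> \<le> 1"
    using \<theta> \<kappa> region_bounds[OF assms] by (intro mult_le_one powr_le1) auto
  then have "16 * E * K * fst p \<le> 1"
    using small[OF assms] by linarith
  then show "16 * K \<le> 1 / (E * fst p)"
    using pos by (simp add: pos_le_divide_eq mult_ac)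
  show "K \<le> 1 / (E * fst p) * (\<theta> * fst p powr \<kappa>) / 16"
    using small[OF assms] pos by (simp add: field_simps)
qed

text \<open>The factor \<open>fst (F p) powr \<kappa>\<close> cancels the singular factor in the
  horizontal component, so the weighted horizontal component is at most \<open>2 * K\<close>. The
  vertical one is at least 15/16 of the stretching, hence at least \<open>15 * K\<close>.\<close>

lemma cone_invariant:
  assumes p: "p \<in> D" and v: "\<theta> * fst p powr \<kappa> * norm v < 1"
  shows "2 \<le> \<bar>fst (DF p (1, v))\<bar>"
    and "\<theta> * fst (F p) powr \<kappa> * norm (snd (DF p (1, v))) < \<bar>fst (DF p (1, v))\<bar>"
proof -
  define m x w n where "m = 1 / (E * fst p)" and "x = fst p powr \<kappa>" and "w = fst (F p) powr \<kappa>"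
    and "n = norm v"
  note bounds = derivative_bounds(1)[OF p] derivative_bounds(2,3)[OF p, of 1 v]
  have w: "0 < w" "w \<le> x"
    using fst_F_bounds[OF p] target[OF p] fst_le_powr[OF p] by (auto simp: w_def x_def)
  have m: "16 * K \<le> m" "K \<le> m * (\<theta> * x) / 16"
    using expansion_bound[OF p] by (auto simp: m_def x_def)
  \<comment> \<open>The cone condition \<open>\<theta> * x * n < 1\<close> turns the weighted form
    of smallness into a bound of the coupling by a sixteenth of the stretching.\<close>
  have "m * (\<theta> * x) / 16 * n = m / 16 * (\<theta> * x * n)"
    by simp
  also have "\<dots> \<le> m / 16"
    using v m K_ge by (simp add: x_def n_def mult_le_cancel_left1)
  finally have "K * n \<le> m / 16"
    using mult_right_mono[OF m(2), of n] by (simp add: n_def)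
  then have a: "15 / 16 * m \<le> \<bar>fst (DF p (1, v))\<bar>"
    using bounds(1,2) abs_triangle_ineq2[of "Ep p / fst p" "fst (DF p (1, v))"]
    by (simp add: m_def n_def abs_minus_commute)
  then show "2 \<le> \<bar>fst (DF p (1, v))\<bar>"
    using m K_ge by linarith
  have "\<theta> * w * norm (snd (DF p (1, v))) \<le> \<theta> * w * (K * (1 / w + n))"
    using bounds(3) w \<theta> by (intro mult_left_mono) (auto simp: w_def n_def)
  also have "\<dots> = K * (\<theta> + \<theta> * w * n)"
    using w by (simp add: field_simps)
  also have "\<dots> \<le> K * 2"
  proof -
    have "\<theta> * w * n \<le> \<theta> * x * n"
      using w \<theta> by (intro mult_right_mono mult_left_mono) (auto simp: n_def)
    then have "\<theta> + \<theta> * w * n \<le> 2"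
      using v \<theta> unfolding x_def n_def by linarith
    then show ?thesis
      using K_ge by (intro mult_left_mono) auto
  qed
  also have "\<dots> < \<bar>fst (DF p (1, v))\<bar>"
    using a m K_ge by linarith
  finally show "\<theta> * fst (F p) powr \<kappa> * norm (snd (DF p (1, v))) < \<bar>fst (DF p (1, v))\<bar>"
    by (simp add: w_def)
qed

text \<open>The ordinary chain rule does not apply, since \<open>g\<close> is differentiable only in
  the weak norm and \<open>F\<close> only relative to the strong one. Strong continuity of
  \<open>g\<close> brings the points within reach of \<open>weak_derivative\<close>, whose error is
  relative to the weak norm, in which the curve has a derivative.\<close>

lemma curve_derivative:
  assumes h: "horizontal \<iota> \<theta> \<kappa> g g' a b" and sub: "trace_of g a b \<subseteq> D" and t: "t \<in> {a..b}"
  shows "((\<lambda>t. incl \<iota> (F (t, g t))) has_vector_derivative DF (t, g t) (1, g' t)) (at t within {a..b})"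
proof -
  define p where "p = (t, g t)"
  define N where "N = norm (1 :: real, g' t)"
  have p: "p \<in> D"
    using sub t by (auto simp: p_def)
  have "((\<lambda>s. (s, \<iota> (g s))) has_vector_derivative (1, g' t)) (at t within {a..b})"
    using h t unfolding horizontal_def by (intro has_vector_derivative_Pair has_vector_derivative_id) auto
  then have i: "\<exists>d>0. \<forall>s\<in>{a..b}. norm (s - t) < d \<longrightarrow>
      norm ((s, \<iota> (g s)) - (t, \<iota> (g t)) - (s - t) *\<^sub>R (1, g' t)) \<le> e * norm (s - t)"
    if "0 < e" for e
    using that unfolding has_vector_derivative_def has_derivative_within_alt by blast
  have cont: "continuous_on {a..b} (\<lambda>s. (s, g s))"
    using h unfolding horizontal_def by (auto intro!: continuous_intros)
  show ?thesis
    unfolding has_vector_derivative_def has_derivative_within_alt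
  proof (intro conjI allI impI bounded_linear_scaleR_left)
    fix e :: real assume e: "0 < e"
    \<comment> \<open>Two errors are to be at most \<open>e / 2\<close> each: the deviation of the
      curve from its tangent, seen through \<open>DF p\<close>, and the error of \<open>F\<close>.
      The 1 in \<open>n\<close> avoids division by zero; the one in \<open>N + 1\<close> comes from
      \<open>e1 \<le> 1\<close> in the bound of the increment.\<close>
    define n where "n = norm (DF p) + 1"
    define e1 where "e1 = min 1 (e / (2 * n))"
    define e2 where "e2 = e / (2 * (N + 1))"
    have N: "0 < N + 1"
      by (simp add: N_def add_nonneg_pos)
    have e12: "0 < e1" "e1 \<le> 1" "norm (DF p) * e1 \<le> e / 2" "0 < e2" "e2 * (N + 1) = e / 2"
    proof -
      have nD: "0 < n"
        using norm_ge_zero[of "DF p"] by (simp add: n_def add_nonneg_pos)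
      show "0 < e1" "e1 \<le> 1"
        using e nD by (auto simp: e1_def)
      have "norm (DF p) * e1 \<le> n * (e / (2 * n))"
        unfolding e1_def using e nD by (intro mult_mono) (auto simp: n_def)
      also have "\<dots> = e / 2"
        using nD by simp
      finally show "norm (DF p) * e1 \<le> e / 2" .
      show "0 < e2" "e2 * (N + 1) = e / 2"
        using e N unfolding e2_def by (auto simp only: times_divide_eq_left mult_divide_mult_cancel_right
          less_irrefl intro: divide_pos_pos mult_pos_pos zero_less_numeral)
    qed
    obtain d1 where d1: "0 < d1" "\<And>s. s \<in> {a..b} \<Longrightarrow> norm (s - t) < d1 \<Longrightarrow>
        norm ((s, \<iota> (g s)) - (t, \<iota> (g t)) - (s - t) *\<^sub>R (1, g' t)) \<le> e1 * norm (s - t)"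
      using i[OF e12(1)] by blast
    obtain d2 where d2: "0 < d2" "\<And>q. q \<in> D \<Longrightarrow> dist q p < d2 \<Longrightarrow>
        norm (incl \<iota> (F q) - incl \<iota> (F p) - DF p (incl \<iota> (q - p))) \<le> e2 * norm (incl \<iota> (q - p))"
      using weak_derivative[OF p e12(4)] by blast
    obtain d3 where d3: "0 < d3" "\<And>s. s \<in> {a..b} \<Longrightarrow> dist s t < d3 \<Longrightarrow> dist (s, g s) p < d2"
      using cont t d2(1) unfolding continuous_on_iff p_def by blast
    show "\<exists>d>0. \<forall>s\<in>{a..b}. norm (s - t) < d \<longrightarrow>
        norm (incl \<iota> (F (s, g s)) - incl \<iota> (F (t, g t)) - (s - t) *\<^sub>R DF (t, g t) (1, g' t))
          \<le> e * norm (s - t)"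
    proof (intro exI[of _ "min d1 d3"] conjI ballI impI)
      fix s assume s: "s \<in> {a..b}" "norm (s - t) < min d1 d3"
      define q where "q = (s, g s)"
      define u where "u = incl \<iota> (q - p)"
      define T where "T = u - (s - t) *\<^sub>R (1, g' t)"
      have T: "norm T \<le> e1 * norm (s - t)"
        using d1(2)[OF s(1)] s(2) by (simp add: T_def u_def q_def p_def \<iota>.diff)
      have q: "q \<in> D" "dist q p < d2"
        using sub s d3(2)[OF s(1)] by (auto simp: q_def dist_real_def)
      have "norm u \<le> norm T + norm ((s - t) *\<^sub>R (1 :: real, g' t))"
        using norm_triangle_ineq[of T "(s - t) *\<^sub>R (1, g' t)"] by (simp add: T_def)
      also have "\<dots> \<le> (N + 1) * norm (s - t)"
        using T mult_right_mono[OF e12(2), of "norm (s - t)"]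
        unfolding norm_scaleR N_def by (simp add: algebra_simps)
      finally have u: "norm u \<le> (N + 1) * norm (s - t)" .
      have "norm (incl \<iota> (F q) - incl \<iota> (F p) - DF p u) \<le> e2 * norm u"
        using d2(2)[OF q] by (simp add: u_def)
      also have "\<dots> \<le> e2 * ((N + 1) * norm (s - t))"
        using u e12 by (intro mult_left_mono) auto
      finally have A: "norm (incl \<iota> (F q) - incl \<iota> (F p) - DF p u) \<le> e / 2 * norm (s - t)"
        using e12(5) by (simp only: mult.assoc[symmetric])
      have "norm (DF p T) \<le> norm (DF p) * norm T"
        by (rule norm_blinfun)
      also have "\<dots> \<le> norm (DF p) * (e1 * norm (s - t))"
        using T by (intro mult_left_mono) auto
      also have "\<dots> \<le> e / 2 * norm (s - t)"
        using mult_right_mono[OF e12(3), of "norm (s - t)"] by (simp add: mult.assoc)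
      finally have B: "norm (DF p T) \<le> e / 2 * norm (s - t)" .
      have eq: "incl \<iota> (F q) - incl \<iota> (F p) - (s - t) *\<^sub>R DF p (1, g' t) =
          (incl \<iota> (F q) - incl \<iota> (F p) - DF p u) + DF p T"
        unfolding T_def by (simp add: blinfun.diff_right blinfun.scaleR_right flip: scaleR_Pair)
      have "norm (incl \<iota> (F q) - incl \<iota> (F p) - (s - t) *\<^sub>R DF p (1, g' t)) \<le>
          norm (incl \<iota> (F q) - incl \<iota> (F p) - DF p u) + norm (DF p T)"
        unfolding eq by (rule norm_triangle_ineq)
      also have "\<dots> \<le> e / 2 * norm (s - t) + e / 2 * norm (s - t)"
        using A B by (rule add_mono)
      also have "\<dots> = e * norm (s - t)"
        by simp
      finally show "norm (incl \<iota> (F (s, g s)) - incl \<iota> (F (t, g t)) - (s - t) *\<^sub>R DF (t, g t) (1, g' t))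
          \<le> e * norm (s - t)"
        by (simp only: q_def p_def)
    qed (use d1 d3 in simp)
  qed
qed

text \<open>The height of the image moves with speed at least 2, so the image is again a graph over
  its height. Its slope is the quotient of the two components of the derivative, and the second part
  of \<open>cone_invariant\<close> is the cone condition for it.\<close>

lemma horizontal_image:
  assumes h: "horizontal \<iota> \<theta> \<kappa> g g' a b" and sub: "trace_of g a b \<subseteq> D"
  obtains k k' c d where "horizontal \<iota> \<theta> \<kappa> k k' c d" "trace_of k c d = F ` trace_of g a b"
    "k ` {c..d} \<subseteq> V"
    "\<forall>s\<in>{a..b}. \<forall>t\<in>{a..b}. 2 * \<bar>s - t\<bar> \<le> \<bar>fst (F (s, g s)) - fst (F (t, g t))\<bar>"
proof -
  define Y where "Y t = fst (F (t, g t))" for t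
  define G where "G t = snd (F (t, g t))" for t
  define \<Delta> where "\<Delta> t = DF (t, g t) (1, g' t)" for t
  have ab: "0 \<le> a" "a < b" "b \<le> 1" and cg: "continuous_on {a..b} g" "continuous_on {a..b} g'"
    using h by (auto simp: horizontal_def)
  have inD: "(t, g t) \<in> D" if "t \<in> {a..b}" for t
    using sub that by auto
  have c\<gamma>: "continuous_on {a..b} (\<lambda>t. (t, g t))"
    using cg by (intro continuous_intros)
  have cF: "continuous_on {a..b} (\<lambda>t. F (t, g t))"
    by (rule continuous_on_compose2[OF continuous_F c\<gamma> sub])
  then have cY: "continuous_on {a..b} Y" and cG: "continuous_on {a..b} G"
    unfolding Y_def G_def by (auto intro: continuous_on_fst continuous_on_snd)
  have c\<Delta>: "continuous_on {a..b} \<Delta>"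
    unfolding \<Delta>_def
  proof (intro continuous_intros cg)
    show "continuous_on {a..b} (\<lambda>t. DF (t, g t))"
      using jump_out sub unfolding jump_out_differentiable_on_def
      by (intro continuous_on_compose2[OF _ c\<gamma> sub]) auto
  qed
  have dY: "(Y has_vector_derivative fst (\<Delta> t)) (at t within {a..b})"
    and dG: "((\<lambda>t. \<iota> (G t)) has_vector_derivative snd (\<Delta> t)) (at t within {a..b})"
    if "t \<in> {a..b}" for t
    using bounded_linear.has_vector_derivative[OF bounded_linear_fst curve_derivative[OF h sub that]]
      bounded_linear.has_vector_derivative[OF bounded_linear_snd curve_derivative[OF h sub that]]
    by (simp_all add: Y_def[abs_def] G_def[abs_def] \<Delta>_def case_prod_beta)
  have \<Delta>: "2 \<le> \<bar>fst (\<Delta> t)\<bar>" "\<theta> * Y t powr \<kappa> * norm (snd (\<Delta> t)) < \<bar>fst (\<Delta> t)\<bar>"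
    if "t \<in> {a..b}" for t
    using cone_invariant[OF inD[OF that], of "g' t"] h that \<kappa>
    by (auto simp: horizontal_def rpower_def \<Delta>_def Y_def)
  have expand: "2 * \<bar>s - t\<bar> \<le> \<bar>Y s - Y t\<bar>" if "s \<in> {a..b}" "t \<in> {a..b}" for s t
  proof -
    have *: "2 * \<bar>s - t\<bar> \<le> \<bar>Y s - Y t\<bar>" if st: "s \<le> t" "s \<in> {a..b}" "t \<in> {a..b}" for s t
    proof -
      have sub': "{s..t} \<subseteq> {a..b}"
        using st by auto
      have "(Y has_derivative (\<lambda>h. h *\<^sub>R fst (\<Delta> x))) (at x within {s..t})" if "s \<le> x" "x \<le> t" for x
        using dY[of x] that st sub' unfolding has_vector_derivative_def
        by (auto intro: has_derivative_subset)
      from mvt_very_simple[OF st(1) this]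
      obtain x where x: "x \<in> {s..t}" "Y t - Y s = (t - s) * fst (\<Delta> x)"
        by auto
      have "2 * \<bar>s - t\<bar> \<le> \<bar>fst (\<Delta> x)\<bar> * \<bar>s - t\<bar>"
        using \<Delta>(1)[of x] x sub' by (intro mult_right_mono) auto
      also have "\<dots> = \<bar>Y t - Y s\<bar>"
        by (simp add: x abs_mult abs_minus_commute)
      finally show ?thesis
        by (simp add: abs_minus_commute)
    qed
    show ?thesis
      using *[of s t] *[of t s] that by (cases "s \<le> t") (auto simp: abs_minus_commute)
  qed
  have inj: "inj_on Y {a..b}"
    using expand by (fastforce intro: inj_onI)
  \<comment> \<open>\<open>Ep\<close> may be negative and \<open>Y\<close> decreasing, so the new
    interval is found as a compact connected image and not from \<open>Y a\<close> and
    \<open>Y b\<close>.\<close>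
  have "connected (Y ` {a..b})" "compact (Y ` {a..b})"
    using cY by (auto intro: connected_continuous_image compact_continuous_image)
  then obtain c d where cd: "Y ` {a..b} = {c..d}"
    using connected_compact_interval_1[of "Y ` {a..b}"] by (auto simp: cbox_interval)
  define H where "H = the_inv_into {a..b} Y"
  have HY: "H (Y t) = t" if "t \<in> {a..b}" for t
    unfolding H_def by (rule the_inv_into_f_f[OF inj that])
  have H: "H s \<in> {a..b} \<and> Y (H s) = s" if s: "s \<in> {c..d}" for s
  proof -
    obtain t where "t \<in> {a..b}" "s = Y t"
      using s unfolding cd[symmetric] by (elim imageE)
    then show ?thesis
      using HY[of t] by simp
  qed
  have imH: "H ` {c..d} = {a..b}"
    unfolding cd[symmetric] using HY by force
  have cH: "continuous_on {c..d} H"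
    unfolding cd[symmetric] using HY by (intro continuous_on_inv[OF cY]) auto
  define k where "k s = G (H s)" for s
  define k' where "k' s = (1 / fst (\<Delta> (H s))) *\<^sub>R snd (\<Delta> (H s))" for s
  have cYab: "Y a \<in> {c..d}" "Y b \<in> {c..d}"
    using cd ab by auto
  show thesis
  proof (rule that)
    show "horizontal \<iota> \<theta> \<kappa> k k' c d"
      unfolding horizontal_def
    proof (intro conjI ballI)
      have "c \<in> {c..d}" "d \<in> {c..d}"
        using cYab by auto
      then obtain t t' where "t \<in> {a..b}" "c = Y t" "t' \<in> {a..b}" "d = Y t'"
        unfolding cd[symmetric] by (elim imageE)
      then show "0 \<le> c" "d \<le> 1"
        using fst_F_bounds[OF inD] by (auto simp: Y_def less_imp_le)
      show "c < d"
        using cYab expand[of a b] ab by auto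
      show "continuous_on {c..d} k"
        unfolding k_def using imH by (intro continuous_on_compose2[OF cG cH]) auto
      have "continuous_on {c..d} (\<lambda>s. \<Delta> (H s))"
        using imH by (intro continuous_on_compose2[OF c\<Delta> cH]) auto
      moreover have "fst (\<Delta> (H s)) \<noteq> 0" if "s \<in> {c..d}" for s
        using \<Delta>(1)[of "H s"] H[OF that] by auto
      ultimately show "continuous_on {c..d} k'"
        unfolding k'_def by (intro continuous_intros) auto
      fix s assume s: "s \<in> {c..d}"
      define t where "t = H s"
      have t: "t \<in> {a..b}" "Y t = s" "fst (\<Delta> t) \<noteq> 0"
        using H[OF s] \<Delta>(1)[of t] by (auto simp: t_def)
      have "(H has_derivative (\<lambda>h. h / fst (\<Delta> t))) (at (Y t) within Y ` {a..b})"
      proof (rule has_derivative_inverse_within)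
        show "(Y has_derivative (\<lambda>h. h *\<^sub>R fst (\<Delta> t))) (at t within {a..b})"
          using dY[OF t(1)] unfolding has_vector_derivative_def .
        show "continuous (at (Y t) within Y ` {a..b}) H"
          using cH s unfolding cd t(2) continuous_on_eq_continuous_within by blast
        show "Real_Vector_Spaces.linear (\<lambda>h. h / fst (\<Delta> t))"
          by (rule linearI) (auto simp: add_divide_distrib)
        show "(\<lambda>h. h / fst (\<Delta> t)) \<circ> (\<lambda>h. h *\<^sub>R fst (\<Delta> t)) = id"
          using t by auto
      qed (use t HY in auto)
      then have "(H has_vector_derivative 1 / fst (\<Delta> t)) (at s within {c..d})"
        unfolding has_vector_derivative_def cd t(2) by simp
      moreover have "((\<lambda>t. \<iota> (G t)) has_vector_derivative snd (\<Delta> t)) (at (H s) within H ` {c..d})"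
        using dG[OF t(1)] unfolding imH t_def .
      ultimately have "((\<lambda>t. \<iota> (G t)) \<circ> H has_vector_derivative k' s) (at s within {c..d})"
        using vector_diff_chain_within unfolding k'_def t_def by blast
      then show "((\<lambda>s. \<iota> (k s)) has_vector_derivative k' s) (at s within {c..d})"
        by (simp add: o_def k_def)
      show "\<theta> * rpower s \<kappa> * norm (k' s) < 1"
        using \<Delta>(2)[OF t(1)] t \<kappa> by (simp add: k'_def rpower_def divide_simps flip: t_def)
    qed
    have "trace_of k c d = (\<lambda>t. (Y t, k (Y t))) ` {a..b}"
      unfolding cd[symmetric] by (simp add: image_image)
    also have "\<dots> = (\<lambda>t. F (t, g t)) ` {a..b}"
      using HY by (intro image_cong refl) (simp add: k_def, simp add: Y_def G_def)
    finally show "trace_of k c d = F ` trace_of g a b"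
      by (simp add: image_image)
    show "k ` {c..d} \<subseteq> V"
      using H snd_F_in[OF inD] by (auto simp: k_def G_def)
    show "\<forall>s\<in>{a..b}. \<forall>t\<in>{a..b}. 2 * \<bar>s - t\<bar> \<le> \<bar>fst (F (s, g s)) - fst (F (t, g t))\<bar>"
      using expand by (simp add: Y_def)
  qed
qed

end

section \<open>The invariant set\<close>

lemma mem_graph_over: "(y, b) \<in> graph_over U w \<longleftrightarrow> b \<in> U \<and> y = w b"
  by (auto simp: graph_over_def)

text \<open>Meant for the signed distance of a curve to a boundary graph, where uniqueness of zeros
  is almost verticality. A negative value would force a zero on either side of it.\<close>

lemma nonneg_between:
  fixes f :: "real \<Rightarrow> real"
  assumes "continuous_on {s..t} f"
    and zero: "\<And>u v. u \<in> {s..t} \<Longrightarrow> v \<in> {s..t} \<Longrightarrow> f u = 0 \<Longrightarrow> f v = 0 \<Longrightarrow> u = v"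
    and "0 \<le> f s" "0 \<le> f t" "x \<in> {s..t}"
  shows "0 \<le> f x"
proof (rule ccontr)
  assume neg: "\<not> 0 \<le> f x"
  have "continuous_on {s..x} f" "continuous_on {x..t} f"
    using assms by (auto intro: continuous_on_subset)
  then obtain u v where "s \<le> u" "u \<le> x" "f u = 0" "x \<le> v" "v \<le> t" "f v = 0"
    using IVT2'[of f x 0 s] IVT'[of f x 0 t] assms neg by auto
  moreover from this have "u = v"
    using assms(5) by - (rule zero, auto)
  ultimately have "x = u"
    by simp
  then show False
    using neg \<open>f u = 0\<close> by simp
qed

context expanding_region
begin

lemma boundary_functions:
  assumes h: "horizontal \<iota> \<theta> \<kappa> g g' a b" and V: "g ` {a..b} \<subseteq> V"
  shows "continuous_on {a..b} (\<lambda>t. t - dm (g t))" "continuous_on {a..b} (\<lambda>t. dp (g t) - t)"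
    and "\<And>u v. u \<in> {a..b} \<Longrightarrow> v \<in> {a..b} \<Longrightarrow> u - dm (g u) = 0 \<Longrightarrow> v - dm (g v) = 0 \<Longrightarrow> u = v"
    and "\<And>u v. u \<in> {a..b} \<Longrightarrow> v \<in> {a..b} \<Longrightarrow> dp (g u) - u = 0 \<Longrightarrow> dp (g v) - v = 0 \<Longrightarrow> u = v"
proof -
  have g: "continuous_on {a..b} g"
    using h by (simp add: horizontal_def)
  have "continuous_on V dm" "continuous_on V dp"
    and m: "meets_once \<iota> \<theta> \<kappa> V (graph_over V dm)" "meets_once \<iota> \<theta> \<kappa> V (graph_over V dp)"
    using vertical_dm vertical_dp by (auto simp: almost_vertical_iff)
  then show "continuous_on {a..b} (\<lambda>t. t - dm (g t))" "continuous_on {a..b} (\<lambda>t. dp (g t) - t)"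
    using V by (auto intro!: continuous_intros continuous_on_compose2[OF _ g])
  show "u = v" if "u \<in> {a..b}" "v \<in> {a..b}" "u - dm (g u) = 0" "v - dm (g v) = 0" for u v
  proof -
    have "(u, g u) \<in> graph_over V dm" "(v, g v) \<in> graph_over V dm"
      using that V by (simp_all add: mem_graph_over image_subset_iff)
    then show ?thesis
      using m(1)[unfolded meets_once_def, rule_format, of g g' a b u v] h V that by simp
  qed
  show "u = v" if "u \<in> {a..b}" "v \<in> {a..b}" "dp (g u) - u = 0" "dp (g v) - v = 0" for u v
  proof -
    have "(u, g u) \<in> graph_over V dp" "(v, g v) \<in> graph_over V dp"
      using that V by (simp_all add: mem_graph_over image_subset_iff)
    then show ?thesis
      using m(2)[unfolded meets_once_def, rule_format, of g g' a b u v] h V that by simp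
  qed
qed

text \<open>To leave \<open>D\<close> and come back, the curve would have to meet one of the
  boundary graphs twice.\<close>

lemma between_in_region:
  assumes h: "horizontal \<iota> \<theta> \<kappa> g g' a b" and V: "g ` {a..b} \<subseteq> V"
    and st: "s \<in> {a..b}" "t \<in> {a..b}" "(s, g s) \<in> D" "(t, g t) \<in> D"
  shows "trace_of g s t \<subseteq> D"
proof -
  note B = boundary_functions[OF h V]
  have sub: "{s..t} \<subseteq> {a..b}"
    using st by auto
  have "(x, g x) \<in> D" if x: "x \<in> {s..t}" for x
  proof -
    have "0 \<le> x - dm (g x)"
      by (rule nonneg_between[of s t]) (use B(1,3) sub x st in \<open>auto simp: region_iff intro: continuous_on_subset\<close>)
    moreover have "0 \<le> dp (g x) - x"
      by (rule nonneg_between[of s t]) (use B(2,4) sub x st in \<open>auto simp: region_iff intro: continuous_on_subset\<close>)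
    ultimately show ?thesis
      using V x sub by (auto simp: region_iff)
  qed
  then show ?thesis
    by auto
qed

text \<open>The order of \<open>s\<close> and \<open>t\<close> is left open; intermediate values are
  therefore taken from connectedness of the image of the whole interval.\<close>

lemma crossing:
  assumes h: "horizontal \<iota> \<theta> \<kappa> g g' a b" and V: "g ` {a..b} \<subseteq> V"
    and st: "s \<in> {a..b}" "t \<in> {a..b}" "s \<le> dm (g s)" "dp (g t) \<le> t"
  obtains u v where "u \<in> {a..b}" "v \<in> {a..b}" "u = dm (g u)" "v = dp (g v)" "u \<noteq> v"
    "(u, g u) \<in> D" "(v, g v) \<in> D"
proof -
  note B = boundary_functions[OF h V]
  have conn: "\<exists>x\<in>{a..b}. f x = 0"
    if "continuous_on {a..b} f" "f s \<le> 0" "0 \<le> f t" for f :: "real \<Rightarrow> real"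
  proof -
    have "connected (f ` {a..b})"
      using that by (intro connected_continuous_image) auto
    then have "0 \<in> f ` {a..b}"
      using st that unfolding connected_iff_interval by blast
    then show ?thesis
      by force
  qed
  have Vs: "g x \<in> V" if "x \<in> {a..b}" for x
    using V that by blast
  obtain u where u: "u \<in> {a..b}" "u - dm (g u) = 0"
    using conn[OF B(1)] st order[OF Vs[of t]] by auto
  obtain v where v: "v \<in> {a..b}" "- (dp (g v) - v) = 0"
    using conn[OF continuous_on_minus[OF B(2)]] st order[OF Vs[of s]] by auto
  show thesis
    by (rule that[of u v])
      (use u v order[OF Vs[OF u(1)]] order[OF Vs[OF v(1)]] in \<open>auto simp: region_iff Vs\<close>)
qed

text \<open>The induction runs over all curves that join the boundary graphs: the part of the image
  between them replaces the curve, and the point found there is traced back to a preimage on the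
  curve.\<close>

lemma crossing_survives:
  assumes "horizontal \<iota> \<theta> \<kappa> g g' a b" "trace_of g a b \<subseteq> D"
    "s \<in> {a..b}" "t \<in> {a..b}" "s = dm (g s)" "t = dp (g t)"
  shows "\<exists>x\<in>{a..b}. \<forall>i\<le>n. (F ^^ i) (x, g x) \<in> D"
  using assms
proof (induction n arbitrary: g g' a b s t)
  case 0
  then have "(s, g s) \<in> D"
    by (auto simp: image_subset_iff)
  then show ?case
    using 0 by auto
next
  case (Suc n)
  obtain k k' c d where k: "horizontal \<iota> \<theta> \<kappa> k k' c d" "trace_of k c d = F ` trace_of g a b"
    "k ` {c..d} \<subseteq> V"
    using horizontal_image[OF Suc.prems(1,2)] by metis
  have ex: "\<exists>y\<in>{c..d}. F (x, g x) = (y, k y)" if "x \<in> {a..b}" for x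
  proof -
    have "F (x, g x) \<in> trace_of k c d"
      unfolding k(2) using that by auto
    then show ?thesis
      by auto
  qed
  obtain y where y: "y \<in> {c..d}" "F (s, g s) = (y, k y)"
    using ex Suc.prems by blast
  obtain z where z: "z \<in> {c..d}" "F (t, g t) = (z, k z)"
    using ex Suc.prems by blast
  have "g s \<in> V" "g t \<in> V"
    using Suc.prems(2-4) by (auto simp: region_iff image_subset_iff)
  \<comment> \<open>Hyperbolicity exchanges the ends: the lower one lands on or above
    \<open>dp\<close>, the upper one on or below \<open>dm\<close>.\<close>
  then have "dp (k y) \<le> y" "z \<le> dm (k z)"
    using hyperbolic y z Suc.prems(5,6) unfolding topologically_hyperbolic_def by metis+
  then obtain u v where uv: "u \<in> {c..d}" "v \<in> {c..d}" "u = dm (k u)" "v = dp (k v)" "u \<noteq> v"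
    "(u, k u) \<in> D" "(v, k v) \<in> D"
    using crossing[OF k(1,3) z(1) y(1)] by metis
  define l r where "l = min u v" and "r = max u v"
  have lr: "c \<le> l" "l < r" "r \<le> d" "u \<in> {l..r}" "v \<in> {l..r}"
    using uv by (auto simp: l_def r_def)
  have "trace_of k l r \<subseteq> D"
    by (rule between_in_region[OF k(1,3)]) (use uv in \<open>auto simp: l_def r_def min_def max_def\<close>)
  then obtain x where x: "x \<in> {l..r}" "\<forall>i\<le>n. (F ^^ i) (x, k x) \<in> D"
    using Suc.IH[OF horizontal_subinterval[OF k(1) lr(1-3)] _ lr(4,5) uv(3,4)] by blast
  have "(x, k x) \<in> F ` trace_of g a b"
    unfolding k(2)[symmetric] using x lr by auto
  then obtain x' where x': "x' \<in> {a..b}" "F (x', g x') = (x, k x)"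
    by auto
  have "(F ^^ i) (x', g x') \<in> D" if "i \<le> Suc n" for i
  proof (cases i)
    case 0
    then show ?thesis
      using x' Suc.prems(2) by auto
  next
    case (Suc j)
    then show ?thesis
      using x' x that by (simp add: funpow_swap1)
  qed
  then show ?case
    using x' by blast
qed

text \<open>\<open>V\<close> is open, so the region need not be closed; a limit can escape only
  through the base, which the third hypothesis excludes.\<close>

lemma limit_in_region:
  assumes "q \<longlonglongrightarrow> l" "\<And>n. q n \<in> D" "snd l \<in> V"
  shows "l \<in> D"
proof -
  have q: "snd (q n) \<in> V" "dm (snd (q n)) \<le> fst (q n)" "fst (q n) \<le> dp (snd (q n))" for n
    using assms(2)[of n] by (cases "q n"; simp add: region_iff)+
  have "(\<lambda>n. snd (q n)) \<longlonglongrightarrow> snd l" and f: "(\<lambda>n. fst (q n)) \<longlonglongrightarrow> fst l"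
    using assms(1) by (auto intro: tendsto_snd tendsto_fst)
  then have "(\<lambda>n. dm (snd (q n))) \<longlonglongrightarrow> dm (snd l)" "(\<lambda>n. dp (snd (q n))) \<longlonglongrightarrow> dp (snd l)"
    using vertical_dm vertical_dp assms(3) q
    by (auto simp: almost_vertical_iff intro!: continuous_on_tendsto_compose[of V])
  then have "dm (snd l) \<le> fst l" "fst l \<le> dp (snd l)"
    using f q by (auto intro: LIMSEQ_le)
  then show ?thesis
    using assms(3) by (cases l) (simp add: region_iff)
qed

abbreviation "W \<equiv> invariant_set D F"

lemma invariant_set_subset: "W \<subseteq> D"
  by (auto simp: invariant_set_def)

lemma invariant_set_F: "p \<in> W \<Longrightarrow> F p \<in> W"
  unfolding invariant_set_def by (auto simp: funpow_swap1 dest: spec[of _ "Suc _"] spec[of _ 1])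

text \<open>\<open>F\<close> is continuous only on \<open>D\<close>, so an iterate cannot be passed
  to the limit at once. Membership of the limit in \<open>D\<close> and convergence are carried
  through the same induction on the number of steps.\<close>

lemma invariant_set_fibre:
  assumes b: "b \<in> V"
  shows "\<exists>y. (y, b) \<in> W"
proof -
  have "horizontal \<iota> \<theta> \<kappa> (\<lambda>_. b) (\<lambda>_. 0) (dm b) (dp b)"
    using order[OF b] by (auto simp: horizontal_def)
  moreover have "trace_of (\<lambda>_. b) (dm b) (dp b) \<subseteq> D"
    using b by (auto simp: region_iff)
  ultimately have "\<exists>x\<in>{dm b..dp b}. \<forall>i\<le>n. (F ^^ i) (x, b) \<in> D" for n
    using crossing_survives[of "\<lambda>_. b" "\<lambda>_. 0" "dm b" "dp b" "dm b" "dp b"] order[OF b] by auto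
  then obtain x where x: "\<And>n. x n \<in> {dm b..dp b}" "\<And>n i. i \<le> n \<Longrightarrow> (F ^^ i) (x n, b) \<in> D"
    by metis
  obtain l r where l: "l \<in> {dm b..dp b}" "strict_mono r" "(x \<circ> r) \<longlonglongrightarrow> l"
    using compact_Icc[of "dm b" "dp b"] x(1) unfolding compact_def by metis
  \<comment> \<open>The shift by \<open>i\<close> matters: \<open>r (n + i) \<ge> i\<close>, so
    every point of the shifted sequence stays in \<open>D\<close> for at least \<open>i\<close>
    steps.\<close>
  have "(F ^^ i) (l, b) \<in> D \<and> (\<lambda>n. (F ^^ i) (x (r (n + i)), b)) \<longlonglongrightarrow> (F ^^ i) (l, b)" for i
  proof (induction i)
    case 0
    then show ?case
      using l b by (auto simp: region_iff o_def intro!: tendsto_intros)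
  next
    case (Suc i)
    have inD: "(F ^^ j) (x (r (n + Suc i)), b) \<in> D" if "j \<le> Suc i" for n j
    proof (rule x(2))
      show "j \<le> r (n + Suc i)"
        using that seq_suble[OF l(2), of "n + Suc i"] by linarith
    qed
    have "(\<lambda>n. (F ^^ i) (x (r (Suc n + i)), b)) \<longlonglongrightarrow> (F ^^ i) (l, b)"
      using Suc.IH by (subst filterlim_sequentially_Suc) simp
    then have "(\<lambda>n. F ((F ^^ i) (x (r (n + Suc i)), b))) \<longlonglongrightarrow> F ((F ^^ i) (l, b))"
      using inD[of i] Suc.IH by (intro continuous_on_tendsto_compose[OF continuous_F]) auto
    then have lim: "(\<lambda>n. (F ^^ Suc i) (x (r (n + Suc i)), b)) \<longlonglongrightarrow> (F ^^ Suc i) (l, b)"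
      by simp
    moreover have "(F ^^ Suc i) (l, b) \<in> D"
      by (rule limit_in_region[OF lim inD]) (use Suc.IH snd_F_in in auto)
    ultimately show ?case
      by simp
  qed
  then have "(F ^^ i) (l, b) \<in> D" for i
    by blast
  from this this[of 0] have "(l, b) \<in> W"
    by (simp add: invariant_set_def)
  then show ?thesis
    by blast
qed

text \<open>The arc between two points of \<open>W\<close> lies in \<open>D\<close>, so
  \<open>F\<close> may be applied to it. Each step at least doubles the difference of heights, which
  never exceeds 1.\<close>

lemma invariant_set_distance:
  assumes "horizontal \<iota> \<theta> \<kappa> g g' a b" "g ` {a..b} \<subseteq> V" "s \<in> {a..b}" "t \<in> {a..b}" "s \<le> t"
    "(s, g s) \<in> W" "(t, g t) \<in> W"
  shows "2 ^ n * \<bar>s - t\<bar> \<le> 1"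
  using assms
proof (induction n arbitrary: g g' a b s t)
  case 0
  then show ?case
    by (auto simp: horizontal_def)
next
  case (Suc n)
  show ?case
  proof (cases "s = t")
    case False
    have st: "a \<le> s" "s < t" "t \<le> b" "(s, g s) \<in> D" "(t, g t) \<in> D"
      using Suc.prems False invariant_set_subset by auto
    note h = horizontal_subinterval[OF Suc.prems(1) st(1-3)]
    note sub = between_in_region[OF Suc.prems(1-4) st(4,5)]
    obtain k k' c d where k: "horizontal \<iota> \<theta> \<kappa> k k' c d" "trace_of k c d = F ` trace_of g s t"
      "k ` {c..d} \<subseteq> V"
      "\<forall>u\<in>{s..t}. \<forall>v\<in>{s..t}. 2 * \<bar>u - v\<bar> \<le> \<bar>fst (F (u, g u)) - fst (F (v, g v))\<bar>"
      by (rule horizontal_image[OF h sub])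
    have "F (s, g s) \<in> trace_of k c d" "F (t, g t) \<in> trace_of k c d"
      unfolding k(2) using st by auto
    then obtain y z where yz: "y \<in> {c..d}" "F (s, g s) = (y, k y)" "z \<in> {c..d}" "F (t, g t) = (z, k z)"
      by auto
    have W: "(y, k y) \<in> W" "(z, k z) \<in> W"
      using invariant_set_F Suc.prems(6,7) yz by metis+
    have "2 ^ n * \<bar>y - z\<bar> \<le> 1"
      using Suc.IH[OF k(1,3) yz(1,3) _ W] Suc.IH[OF k(1,3) yz(3,1) _ W(2,1)]
      by (cases "y \<le> z") (auto simp: abs_minus_commute)
    moreover have "2 * \<bar>s - t\<bar> \<le> \<bar>y - z\<bar>"
      using k(4)[rule_format, of s t] yz st by simp
    then have "2 ^ n * (2 * \<bar>s - t\<bar>) \<le> 2 ^ n * \<bar>y - z\<bar>"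
      by (rule mult_left_mono) simp
    ultimately have "2 ^ n * (2 * \<bar>s - t\<bar>) \<le> 1"
      by linarith
    then show ?thesis
      by (simp only: power_Suc mult.assoc mult.left_commute)
  qed simp
qed

lemma invariant_set_meets_once: "meets_once \<iota> \<theta> \<kappa> V W"
proof -
  have *: "s = t" if "horizontal \<iota> \<theta> \<kappa> g g' a b" "g ` {a..b} \<subseteq> V" "s \<in> {a..b}" "t \<in> {a..b}" "s \<le> t"
    "(s, g s) \<in> W" "(t, g t) \<in> W" for g g' a b s t
  proof (rule ccontr)
    assume "s \<noteq> t"
    then obtain n where "1 / \<bar>s - t\<bar> < 2 ^ n"
      using real_arch_pow[of 2 "1 / \<bar>s - t\<bar>"] by auto
    then have "1 < 2 ^ n * \<bar>s - t\<bar>"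
      using \<open>s \<noteq> t\<close> by (simp add: field_simps)
    then show False
      using invariant_set_distance[OF that, of n] by linarith
  qed
  show ?thesis
    unfolding meets_once_def
  proof (intro allI impI, elim conjE)
    fix g g' a b s t
    assume "horizontal \<iota> \<theta> \<kappa> g g' a b" "g ` {a..b} \<subseteq> V" "s \<in> {a..b}" "t \<in> {a..b}"
      "(s, g s) \<in> W" "(t, g t) \<in> W"
    then show "s = t"
      using *[of g g' a b s t] *[of g g' a b t s] by (cases "s \<le> t") auto
  qed
qed

definition "\<omega> b = (THE y. (y, b) \<in> W)"

lemma invariant_set_bounds: "(y, b) \<in> W \<Longrightarrow> b \<in> V \<and> 0 < y \<and> y < 1"
  using invariant_set_subset region_bounds[of "(y, b)"] by auto

text \<open>Two points in one fibre have the same base point, so the Lipschitz estimate leaves no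
  distance between them.\<close>

lemma invariant_set_iff: "(y, b) \<in> W \<longleftrightarrow> b \<in> V \<and> y = \<omega> b"
proof -
  have "y = z" if W: "(y, b) \<in> W" "(z, b) \<in> W" for y z b
  proof -
    obtain r where "0 < r" "ball b r \<subseteq> V"
      using open_V invariant_set_bounds[OF W(1)] open_contains_ball by blast
    then have "\<bar>y - z\<bar> \<le> norm (\<iota> b - \<iota> b)"
      using invariant_set_bounds[OF W(1)] invariant_set_bounds[OF W(2)] W
      by (intro meets_once_lipschitz_1[OF invariant_set_meets_once]) auto
    then show ?thesis
      by simp
  qed
  then have "b \<in> V \<Longrightarrow> \<exists>!y. (y, b) \<in> W"
    using invariant_set_fibre by blast
  then show ?thesis
    unfolding \<omega>_def using invariant_set_bounds by (metis (no_types, lifting) theI)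
qed

lemma invariant_set_graph: "W = graph_over V \<omega>"
  by (auto simp: graph_over_def invariant_set_iff image_iff)

lemma continuous_\<omega>: "continuous_on V \<omega>"
  unfolding continuous_on_iff
proof (intro ballI allI impI)
  fix b and e :: real assume b: "b \<in> V" "0 < e"
  obtain r where r: "0 < r" "ball b r \<subseteq> V"
    using open_V b(1) open_contains_ball by blast
  have "dist (\<omega> c) (\<omega> b) < e" if "c \<in> V" "dist c b < min r e" for c
  proof -
    have W: "(\<omega> c, c) \<in> W" "(\<omega> b, b) \<in> W"
      using that b by (auto simp: invariant_set_iff)
    have "\<bar>\<omega> c - \<omega> b\<bar> \<le> norm (\<iota> c - \<iota> b)"
      using invariant_set_bounds[OF W(1)] invariant_set_bounds[OF W(2)] that r
      by (intro meets_once_lipschitz_1[OF invariant_set_meets_once r(2) W]) (auto simp: dist_commute)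
    also have "\<dots> \<le> norm (c - b)"
      using norm_le[of "c - b"] by (simp add: \<iota>.diff)
    finally show ?thesis
      using that by (simp add: dist_real_def dist_norm)
  qed
  then show "\<exists>d>0. \<forall>c\<in>V. dist c b < d \<longrightarrow> dist (\<omega> c) (\<omega> b) < e"
    using r b by (intro exI[of _ "min r e"]) auto
qed

lemma almost_vertical_\<omega>: "almost_vertical \<iota> \<theta> \<kappa> V \<omega>"
  using continuous_\<omega> invariant_set_meets_once by (simp add: almost_vertical_iff invariant_set_graph)

end

section \<open>Tangent covectors\<close>

definition blinfun_inr :: "'a::real_normed_vector \<Rightarrow>\<^sub>L ('c::real_normed_vector \<times> 'a)" where
  "blinfun_inr = Blinfun (\<lambda>v. (0, v))"

lemma blinfun_inr_apply [simp]: "blinfun_inr v = (0, v)"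
  unfolding blinfun_inr_def
  by (simp add: bounded_linear_Blinfun_apply bounded_linear_Pair bounded_linear_ident)

text \<open>The covector \<open>(1, - \<alpha>)\<close> pulled back by \<open>L\<close>, not yet
  normalised to have first component 1.\<close>

definition pull :: "(real \<times> 'a) \<Rightarrow>\<^sub>L (real \<times> 'a) \<Rightarrow> ('a::real_normed_vector \<Rightarrow>\<^sub>L real)
    \<Rightarrow> (real \<times> 'a) \<Rightarrow>\<^sub>L real" where
  "pull L \<alpha> = (fst_blinfun - (\<alpha> o\<^sub>L snd_blinfun)) o\<^sub>L L"

text \<open>If the kernel of \<open>(1, - \<alpha>)\<close> is tangent at \<open>F p\<close>, the kernel of \<open>(1, - transform (DF p) \<alpha>)\<close> is
  tangent at \<open>p\<close>.\<close>

definition transform :: "(real \<times> 'a) \<Rightarrow>\<^sub>L (real \<times> 'a) \<Rightarrow> ('a::real_normed_vector \<Rightarrow>\<^sub>L real)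
    \<Rightarrow> 'a \<Rightarrow>\<^sub>L real" where
  "transform L \<alpha> = (- 1 / pull L \<alpha> (1, 0)) *\<^sub>R (pull L \<alpha> o\<^sub>L blinfun_inr)"

lemma pull_apply: "pull L \<alpha> u = fst (L u) - \<alpha> (snd (L u))"
  by (simp add: pull_def blinfun.diff_left)

lemma transform_apply: "transform L \<alpha> v = - pull L \<alpha> (0, v) / pull L \<alpha> (1, 0)"
  by (simp add: transform_def blinfun.scaleR_left blinfun.minus_left)

lemma tendsto_transform:
  assumes "pull L \<alpha> (1, 0) \<noteq> 0" "(f \<longlongrightarrow> L) G" "(h \<longlongrightarrow> \<alpha>) G"
  shows "((\<lambda>q. transform (f q) (h q)) \<longlongrightarrow> transform L \<alpha>) G"
  using assms unfolding transform_def pull_def by (intro tendsto_intros) auto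

context expanding_region
begin

text \<open>The bound on \<alpha> says that the kernel of \<open>(1, - \<alpha>)\<close> avoids the
  cone at \<open>F p\<close>. Its weight cancels the singular factor again, so \<alpha> contributes
  at most \<open>K\<close> on \<open>(1, 0)\<close> and \<open>K * norm v\<close> on
  \<open>(0, v)\<close>.\<close>

lemma pull_bounds:
  assumes p: "p \<in> D" and \<alpha>: "norm \<alpha> \<le> \<theta> * fst (F p) powr \<kappa>"
  shows "1 / (E * fst p) / 2 \<le> \<bar>pull (DF p) \<alpha> (1, 0)\<bar>"
    and "\<bar>pull (DF p) \<alpha> (0, v)\<bar> \<le> 2 * K * norm v"
proof -
  define w where "w = fst (F p) powr \<kappa>"
  have w: "0 < w" "w \<le> 1"
    using fst_F_bounds[OF p] target[OF p] region_bounds[OF p] by (auto simp: w_def)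
  have *: "\<bar>\<alpha> (snd (DF p (a, v)))\<bar> \<le> K * (\<bar>a\<bar> + w * norm v)" for a v
  proof -
    have "\<bar>\<alpha> (snd (DF p (a, v)))\<bar> \<le> norm \<alpha> * norm (snd (DF p (a, v)))"
      using norm_blinfun[of \<alpha>] by simp
    also have "\<dots> \<le> w * (K * (\<bar>a\<bar> / w + norm v))"
    proof (rule mult_mono)
      show "norm \<alpha> \<le> w"
        using \<alpha> \<theta> w by (smt (verit) mult_left_le_one_le w_def)
      show "norm (snd (DF p (a, v))) \<le> K * (\<bar>a\<bar> / w + norm v)"
        using derivative_bounds(3)[OF p] by (simp add: w_def)
    qed (use w in auto)
    also have "\<dots> = K * (\<bar>a\<bar> + w * norm v)"
      using w by (simp add: field_simps)
    finally show ?thesis .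
  qed
  have a: "\<bar>fst (DF p (1, 0)) - Ep p / fst p\<bar> \<le> 0"
    using derivative_bounds(2)[OF p, of 1 0] by simp
  have "\<bar>\<alpha> (snd (DF p (1, 0)))\<bar> \<le> K"
    using *[of 1 0] by simp
  moreover have "\<bar>pull (DF p) \<alpha> (1, 0)\<bar> \<ge> \<bar>fst (DF p (1, 0))\<bar> - \<bar>\<alpha> (snd (DF p (1, 0)))\<bar>"
    unfolding pull_apply by (rule abs_triangle_ineq2)
  moreover have "16 * K \<le> 1 / (E * fst p)"
    by (rule expansion_bound[OF p])
  ultimately show "1 / (E * fst p) / 2 \<le> \<bar>pull (DF p) \<alpha> (1, 0)\<bar>"
    using a derivative_bounds(1)[OF p] K_ge by simp
  have "\<bar>fst (DF p (0, v))\<bar> \<le> K * norm v"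
    using derivative_bounds(2)[OF p, of 0 v] by simp
  moreover have "w * norm v \<le> norm v"
    using w by (simp add: mult_left_le_one_le)
  then have "K * (w * norm v) \<le> K * norm v"
    using K_ge by simp
  then have "\<bar>\<alpha> (snd (DF p (0, v)))\<bar> \<le> K * norm v"
    using *[of 0 v] by simp
  ultimately show "\<bar>pull (DF p) \<alpha> (0, v)\<bar> \<le> 2 * K * norm v"
    unfolding pull_apply using abs_triangle_ineq4[of "fst (DF p (0, v))" "\<alpha> (snd (DF p (0, v)))"]
    by linarith
qed

lemma pull_nonzero:
  assumes "p \<in> D" "norm \<alpha> \<le> \<theta> * fst (F p) powr \<kappa>"
  shows "pull (DF p) \<alpha> (1, 0) \<noteq> 0"
  using pull_bounds(1)[OF assms] expansion_bound(1)[OF assms(1)] K_ge by auto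

lemma pull_transform:
  assumes "p \<in> D" "norm \<alpha> \<le> \<theta> * fst (F p) powr \<kappa>"
  shows "pull (DF p) \<alpha> (a, v) = pull (DF p) \<alpha> (1, 0) * (a - transform (DF p) \<alpha> v)"
proof -
  have "pull (DF p) \<alpha> (a, v) = pull (DF p) \<alpha> (a *\<^sub>R (1, 0) + (0, v))"
    by simp
  also have "\<dots> = a * pull (DF p) \<alpha> (1, 0) + pull (DF p) \<alpha> (0, v)"
    by (simp only: blinfun.add_right blinfun.scaleR_right real_scaleR_def)
  finally show ?thesis
    using pull_nonzero[OF assms] by (simp add: transform_apply field_simps)
qed

text \<open>Division by \<open>pull (DF p) \<alpha> (1, 0)\<close>, which is at least half of the
  stretching; the two bounds correspond to the two parts of \<open>expansion_bound\<close>. The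
  first produces the weight, the second serves where \<open>s\<close> already carries it.\<close>

lemma transform_estimate:
  assumes p: "p \<in> D" and \<alpha>: "norm \<alpha> \<le> \<theta> * fst (F p) powr \<kappa>"
    and "\<bar>pull (DF p) \<alpha> (a, v)\<bar> \<le> s * K"
  shows "\<bar>a - transform (DF p) \<alpha> v\<bar> \<le> s * (\<theta> * fst p powr \<kappa>) / 8" "\<bar>a - transform (DF p) \<alpha> v\<bar> \<le> s / 8"
proof -
  define m where "m = 1 / (E * fst p)"
  have m: "16 * K \<le> m" "K \<le> m * (\<theta> * fst p powr \<kappa>) / 16"
    using expansion_bound[OF p] by (auto simp: m_def)
  have m_pos: "0 < m"
    using m(1) K_ge by linarith
  have "m / 2 * \<bar>a - transform (DF p) \<alpha> v\<bar> \<le> \<bar>pull (DF p) \<alpha> (1, 0)\<bar> * \<bar>a - transform (DF p) \<alpha> v\<bar>"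
    using pull_bounds(1)[OF p \<alpha>] by (intro mult_right_mono) (auto simp: m_def)
  also have "\<dots> = \<bar>pull (DF p) \<alpha> (a, v)\<bar>"
    unfolding pull_transform[OF p \<alpha>, of a v] by (simp add: abs_mult)
  also have "\<dots> \<le> s * K"
    by fact
  finally have *: "m / 2 * \<bar>a - transform (DF p) \<alpha> v\<bar> \<le> s * K" .
  have "0 \<le> s * K"
    using assms(3) by linarith
  then have s: "0 \<le> s"
    using K_ge by (simp add: zero_le_mult_iff)
  have "m / 2 * \<bar>a - transform (DF p) \<alpha> v\<bar> \<le> m / 2 * (s * (\<theta> * fst p powr \<kappa>) / 8)"
    using * mult_left_mono[OF m(2) s] by (simp add: mult_ac)
  then show "\<bar>a - transform (DF p) \<alpha> v\<bar> \<le> s * (\<theta> * fst p powr \<kappa>) / 8"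
    by (rule mult_left_le_imp_le) (use m_pos in simp)
  have "m / 2 * \<bar>a - transform (DF p) \<alpha> v\<bar> \<le> m / 2 * (s / 8)"
    using * mult_left_mono[OF m(1) s] by (simp add: mult_ac)
  then show "\<bar>a - transform (DF p) \<alpha> v\<bar> \<le> s / 8"
    by (rule mult_left_le_imp_le) (use m_pos in simp)
qed

text \<open>The dual of \<open>cone_invariant\<close>: kernels that avoid the cones are pulled back
  to kernels that avoid the cones.\<close>

lemma norm_transform:
  assumes p: "p \<in> D" and \<alpha>: "norm \<alpha> \<le> \<theta> * fst (F p) powr \<kappa>"
  shows "norm (transform (DF p) \<alpha>) \<le> \<theta> * fst p powr \<kappa>"
proof (rule norm_blinfun_bound)
  fix v
  have "\<bar>0 - transform (DF p) \<alpha> v\<bar> \<le> 2 * norm v * (\<theta> * fst p powr \<kappa>) / 8"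
    using pull_bounds(2)[OF p \<alpha>, of v] by (intro transform_estimate(1)[OF p \<alpha>]) (simp add: mult_ac)
  moreover have "0 \<le> norm v * (\<theta> * fst p powr \<kappa>)"
    using \<theta> by simp
  ultimately show "norm (transform (DF p) \<alpha> v) \<le> \<theta> * fst p powr \<kappa> * norm v"
    by (simp add: mult_ac)
qed (use \<theta> in simp)

text \<open>On a vector \<open>(a, v)\<close> annihilated by the pull-back of \<alpha>, the
  pull-back of \<beta> is the value of \<open>\<alpha> - \<beta>\<close> on the horizontal component
  of the image. The weight of the hypothesis cancels the singular factor there, and dividing by the
  stretching leaves even a quarter of \<open>c\<close>.\<close>

lemma transform_contraction:
  assumes p: "p \<in> D" and \<alpha>: "norm \<alpha> \<le> \<theta> * fst (F p) powr \<kappa>" and \<beta>: "norm \<beta> \<le> \<theta> * fst (F p) powr \<kappa>"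
    and c: "0 \<le> c" "norm (\<alpha> - \<beta>) \<le> c * fst (F p) powr \<kappa>"
  shows "norm (transform (DF p) \<alpha> - transform (DF p) \<beta>) \<le> c / 2 * fst p powr \<kappa>"
proof (rule norm_blinfun_bound)
  fix v
  define x w a where "x = fst p powr \<kappa>" and "w = fst (F p) powr \<kappa>" and "a = transform (DF p) \<alpha> v"
  have w: "0 < w" "w \<le> x"
    using fst_F_bounds[OF p] target[OF p] fst_le_powr[OF p] by (auto simp: w_def x_def)
  have "\<bar>a\<bar> \<le> norm (transform (DF p) \<alpha>) * norm v"
    using norm_blinfun[of "transform (DF p) \<alpha>" v] by (simp add: a_def)
  also have "\<dots> \<le> \<theta> * x * norm v"
    using norm_transform[OF p \<alpha>] by (intro mult_right_mono) (auto simp: x_def)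
  also have "\<dots> \<le> x * norm v"
    using \<theta> w by (intro mult_right_mono) (auto simp: mult_left_le_one_le)
  finally have a: "\<bar>a\<bar> \<le> x * norm v" .
  have "pull (DF p) \<alpha> (a, v) = 0"
    unfolding pull_transform[OF p \<alpha>, of a v] by (simp add: a_def)
  then have "pull (DF p) \<beta> (a, v) = (\<alpha> - \<beta>) (snd (DF p (a, v)))"
    by (simp add: pull_apply blinfun.diff_left)
  also have "\<bar>\<dots>\<bar> \<le> norm (\<alpha> - \<beta>) * norm (snd (DF p (a, v)))"
    using norm_blinfun[of "\<alpha> - \<beta>"] by simp
  also have "\<dots> \<le> (c * w) * (K * (\<bar>a\<bar> / w + norm v))"
    using c w derivative_bounds(3)[OF p, of a v] by (intro mult_mono) (auto simp: w_def)
  also have "\<dots> = c * (\<bar>a\<bar> + w * norm v) * K"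
    using w by (simp add: field_simps)
  also have "\<dots> \<le> c * (x * norm v + x * norm v) * K"
    using c a w K_ge by (intro mult_right_mono mult_left_mono add_mono) auto
  finally have "\<bar>a - transform (DF p) \<beta> v\<bar> \<le> c * (x * norm v + x * norm v) / 8"
    by (rule transform_estimate(2)[OF p \<beta>])
  moreover have "0 \<le> c * (x * norm v)"
    using c w by simp
  ultimately show "norm ((transform (DF p) \<alpha> - transform (DF p) \<beta>) v) \<le> c / 2 * fst p powr \<kappa> * norm v"
    by (simp add: blinfun.diff_left a_def x_def algebra_simps)
qed (use c in simp)

text \<open>Pull-back along \<open>n\<close> steps of the orbit. The zero functional satisfies the
  norm bound everywhere and lets the telescoping sum of differences start without a
  constant.\<close>

primrec approx :: "nat \<Rightarrow> real \<times> 'b \<Rightarrow> 'a \<Rightarrow>\<^sub>L real" where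
  "approx 0 = (\<lambda>p. 0)"
| "approx (Suc n) = (\<lambda>p. transform (DF p) (approx n (F p)))"

lemma norm_approx: "p \<in> W \<Longrightarrow> norm (approx n p) \<le> \<theta> * fst p powr \<kappa>"
proof (induction n arbitrary: p)
  case 0
  then show ?case
    using \<theta> by simp
next
  case (Suc n)
  have "p \<in> D"
    using Suc.prems invariant_set_subset by blast
  then show ?case
    using norm_transform[of p "approx n (F p)"] Suc.IH[OF invariant_set_F[OF Suc.prems]] by simp
qed

lemma approx_diff: "p \<in> W \<Longrightarrow> norm (approx (Suc n) p - approx n p) \<le> (1 / 2) ^ n * fst p powr \<kappa>"
proof (induction n arbitrary: p)
  case 0
  then have "norm (approx (Suc 0) p) \<le> \<theta> * fst p powr \<kappa>"
    by (rule norm_approx)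
  also have "\<dots> \<le> fst p powr \<kappa>"
    using \<theta> by (simp add: mult_left_le_one_le)
  finally show ?case
    by simp
next
  case (Suc n)
  have "norm (transform (DF p) (approx (Suc n) (F p)) - transform (DF p) (approx n (F p)))
      \<le> (1 / 2) ^ n / 2 * fst p powr \<kappa>"
    using Suc.prems invariant_set_F invariant_set_subset
    by (intro transform_contraction norm_approx Suc.IH) auto
  then show ?case
    by simp
qed

lemma continuous_F_W: "continuous_on W F" and continuous_DF_W: "continuous_on W DF"
  using continuous_F jump_out invariant_set_subset
  by (auto simp: jump_out_differentiable_on_def intro: continuous_on_subset)

lemma continuous_approx: "continuous_on W (approx n)"
proof (induction n)
  case (Suc n)
  have "continuous_on W (\<lambda>p. approx n (F p))"
    using Suc.IH continuous_F_W invariant_set_F by (auto intro: continuous_on_compose2)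
  moreover have "pull (DF p) (approx n (F p)) (1, 0) \<noteq> 0" if "p \<in> W" for p
    using that invariant_set_F[OF that] invariant_set_subset by (intro pull_nonzero norm_approx) auto
  ultimately show ?case
    using continuous_DF_W unfolding continuous_on_def by (auto intro: tendsto_transform)
qed simp

text \<open>The limit of \<open>approx\<close>, written as a series with geometrically decaying
  terms in the complete space of functionals.\<close>

definition covector :: "real \<times> 'b \<Rightarrow> 'a \<Rightarrow>\<^sub>L real" where
  "covector p = (\<Sum>n. approx (Suc n) p - approx n p)"

lemma uniform_limit_approx: "uniform_limit W approx covector sequentially"
proof -
  have "uniform_limit W (\<lambda>n p. \<Sum>i<n. approx (Suc i) p - approx i p) covector sequentially"
    unfolding covector_def[abs_def]
  proof (rule Weierstrass_m_test)
    show "norm (approx (Suc n) p - approx n p) \<le> (1 / 2) ^ n" if "p \<in> W" for n p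
    proof -
      have "fst p powr \<kappa> \<le> 1"
        using that invariant_set_subset region_bounds[of p] \<kappa> by (intro powr_le1) auto
      then have "(1 / 2) ^ n * fst p powr \<kappa> \<le> (1 / 2) ^ n"
        by (simp add: mult_left_le)
      then show ?thesis
        using approx_diff[OF that, of n] by linarith
    qed
    show "summable (\<lambda>n. (1 / 2 :: real) ^ n)"
      by (rule summable_geometric) simp
  qed
  moreover have "(\<Sum>i<n. approx (Suc i) p - approx i p) = approx n p" for n p
    using sum_lessThan_telescope[of "\<lambda>i. approx i p" n] by simp
  ultimately show ?thesis
    by (simp only:)
qed

lemma approx_tendsto: "p \<in> W \<Longrightarrow> (\<lambda>n. approx n p) \<longlonglongrightarrow> covector p"
  using uniform_limit_approx by (rule tendsto_uniform_limitI)

lemma continuous_covector: "continuous_on W covector"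
  by (rule uniform_limit_theorem[OF _ uniform_limit_approx]) (auto simp: continuous_approx)

lemma norm_covector: "p \<in> W \<Longrightarrow> norm (covector p) \<le> \<theta> * fst p powr \<kappa>"
  using norm_approx by (intro LIMSEQ_le_const2[OF tendsto_norm[OF approx_tendsto]]) auto

lemma covector_invariant:
  assumes "p \<in> W"
  shows "transform (DF p) (covector (F p)) = covector p"
proof (rule LIMSEQ_unique)
  have "p \<in> D" "F p \<in> W"
    using assms invariant_set_subset invariant_set_F by auto
  then show "(\<lambda>n. approx (Suc n) p) \<longlonglongrightarrow> transform (DF p) (covector (F p))"
    using tendsto_transform[OF pull_nonzero[OF _ norm_covector] tendsto_const approx_tendsto] by simp
  show "(\<lambda>n. approx (Suc n) p) \<longlonglongrightarrow> covector p"
    using approx_tendsto[OF assms] by (rule LIMSEQ_Suc)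
qed

section \<open>Differentiability of the invariant set\<close>

definition tangent_up_to :: "real \<Rightarrow> bool" where
  "tangent_up_to c \<longleftrightarrow> (\<forall>p\<in>W. \<exists>d>0. \<forall>q\<in>W. dist q p < d \<longrightarrow>
     \<bar>fst q - fst p - covector p (\<iota> (snd q - snd p))\<bar> \<le> c * fst p powr \<kappa> * norm (\<iota> (snd q - snd p)))"

lemma invariant_set_lipschitz:
  assumes p: "p \<in> W"
  shows "\<exists>d>0. \<forall>q\<in>W. dist q p < d \<longrightarrow>
    \<bar>fst q - fst p\<bar> \<le> 2 * \<theta> * fst p powr \<kappa> * norm (\<iota> (snd q - snd p))"
proof -
  obtain y b where yb: "p = (y, b)"
    by (cases p)
  have b: "b \<in> V" "0 < y" "y < 1"
    using invariant_set_bounds p by (auto simp: yb)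
  obtain r where r: "0 < r" "ball b r \<subseteq> V"
    using open_V b(1) open_contains_ball by blast
  show ?thesis
  \<comment> \<open>The radius \<open>y\<close> keeps the other height below \<open>2 * y\<close>,
    so the larger of the two weights is at most twice the weight at \<open>p\<close>.\<close>
  proof (intro exI[of _ "min r y"] conjI ballI impI)
    fix q assume q: "q \<in> W" "dist q p < min r y"
    obtain z c where zc: "q = (z, c)"
      by (cases q)
    have z: "0 < z" "z < 1" "c \<in> ball b r" "z \<le> 2 * y"
      using q invariant_set_bounds[of z c] dist_fst_le[of q p] dist_snd_le[of q p]
      by (auto simp: zc yb dist_commute dist_real_def)
    have "\<bar>z - y\<bar> \<le> \<theta> * max z y powr \<kappa> * norm (\<iota> c - \<iota> b)"
      using p q z b r \<kappa> \<theta> unfolding yb zc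
      by (intro meets_once_lipschitz[OF bounded_linear_\<iota> _ _ invariant_set_meets_once, of "ball b r"]) auto
    also have "\<dots> \<le> \<theta> * (2 * y powr \<kappa>) * norm (\<iota> c - \<iota> b)"
    proof (intro mult_right_mono mult_left_mono)
      have "max z y powr \<kappa> \<le> (2 * y) powr \<kappa>"
        using z b \<kappa> by (intro powr_mono2) auto
      also have "\<dots> = 2 powr \<kappa> * y powr \<kappa>"
        using b by (simp add: powr_mult)
      also have "\<dots> \<le> 2 powr 1 * y powr \<kappa>"
        using \<kappa> by (intro mult_right_mono powr_mono) auto
      finally show "max z y powr \<kappa> \<le> 2 * y powr \<kappa>"
        by simp
    qed (use \<theta> in auto)
    finally show "\<bar>fst q - fst p\<bar> \<le> 2 * \<theta> * fst p powr \<kappa> * norm (\<iota> (snd q - snd p))"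
      by (simp add: yb zc \<iota>.diff mult_ac)
  qed (use r b in simp)
qed

text \<open>A crude start: 2 comes from \<open>invariant_set_lipschitz\<close> and 1 from the norm
  of the covector.\<close>

lemma tangent_up_to_3: "tangent_up_to 3"
  unfolding tangent_up_to_def
proof
  fix p assume p: "p \<in> W"
  obtain d where d: "0 < d" "\<And>q. q \<in> W \<Longrightarrow> dist q p < d \<Longrightarrow>
      \<bar>fst q - fst p\<bar> \<le> 2 * \<theta> * fst p powr \<kappa> * norm (\<iota> (snd q - snd p))"
    using invariant_set_lipschitz[OF p] by blast
  show "\<exists>d>0. \<forall>q\<in>W. dist q p < d \<longrightarrow>
     \<bar>fst q - fst p - covector p (\<iota> (snd q - snd p))\<bar> \<le> 3 * fst p powr \<kappa> * norm (\<iota> (snd q - snd p))"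
  proof (intro exI[of _ d] conjI ballI impI)
    fix q assume q: "q \<in> W" "dist q p < d"
    define v where "v = \<iota> (snd q - snd p)"
    have "\<bar>covector p v\<bar> \<le> norm (covector p) * norm v"
      using norm_blinfun[of "covector p" v] by simp
    also have "\<dots> \<le> \<theta> * fst p powr \<kappa> * norm v"
      using norm_covector[OF p] by (intro mult_right_mono) auto
    finally have "\<bar>covector p v\<bar> \<le> \<theta> * fst p powr \<kappa> * norm v" .
    then have "\<bar>fst q - fst p - covector p v\<bar> \<le> 3 * (\<theta> * (fst p powr \<kappa> * norm v))"
      using d(2)[OF q] abs_triangle_ineq4[of "fst q - fst p" "covector p v"]
      by (simp add: v_def mult.assoc)
    also have "\<theta> * (fst p powr \<kappa> * norm v) \<le> fst p powr \<kappa> * norm v"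
      using \<theta> by (intro mult_left_le_one_le) auto
    finally show "\<bar>fst q - fst p - covector p (\<iota> (snd q - snd p))\<bar>
        \<le> 3 * fst p powr \<kappa> * norm (\<iota> (snd q - snd p))"
      by (simp add: v_def mult.assoc)
  qed (use d in simp)
qed

text \<open>The computation of \<open>transform_contraction\<close> with the secant
  \<open>(a, v)\<close> in place of a tangent vector: tangency at \<open>F p\<close> controls the
  pull-back on the secant, up to the error of linearising \<open>F\<close>.\<close>

lemma tangent_up_to_half:
  assumes c: "0 < c" and t: "tangent_up_to c"
  shows "tangent_up_to (c / 2)"
  unfolding tangent_up_to_def
proof
  fix p assume p: "p \<in> W"
  have pD: "p \<in> D" and Fp: "F p \<in> W"
    using p invariant_set_subset invariant_set_F by auto
  define x w where "x = fst p powr \<kappa>" and "w = fst (F p) powr \<kappa>"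
  have w: "0 < w" "w \<le> x" "w \<le> 1"
    using fst_F_bounds[OF pD] target[OF pD] fst_le_powr[OF pD] region_bounds[OF pD]
    by (auto simp: w_def x_def)
  define \<alpha> where "\<alpha> = covector (F p)"
  have \<alpha>: "norm \<alpha> \<le> \<theta> * fst (F p) powr \<kappa>" "transform (DF p) \<alpha> = covector p"
    using norm_covector[OF Fp] covector_invariant[OF p] by (auto simp: \<alpha>_def)
  have n\<alpha>: "norm \<alpha> \<le> 1"
    using \<alpha>(1) \<theta> w by (smt (verit) mult_left_le_one_le w_def)
  \<comment> \<open>The linearisation error will enter with total
    \<open>e * (3 * c + 6) * n\<close>, which this choice makes \<open>c * K * x * n\<close>.
    Together with \<open>3 * c * K * x * n\<close> from the tangency error at \<open>F p\<close>
    this is \<open>4 * c * K * x * n\<close>, and the factor 1/8 of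
    \<open>transform_estimate\<close> leaves \<open>c / 2\<close>.\<close>
  define e where "e = c * K * x / (3 * c + 6)"
  have e: "0 < e" "e * (3 * c + 6) = c * K * x"
    using c K_ge w by (auto simp: e_def)
  obtain d1 where d1: "0 < d1" "\<And>q. q \<in> W \<Longrightarrow> dist q p < d1 \<Longrightarrow>
      \<bar>fst q - fst p\<bar> \<le> 2 * \<theta> * x * norm (\<iota> (snd q - snd p))"
    using invariant_set_lipschitz[OF p] unfolding x_def by blast
  obtain d2 where d2: "0 < d2" "\<And>q. q \<in> D \<Longrightarrow> dist q p < d2 \<Longrightarrow>
    norm (incl \<iota> (F q) - incl \<iota> (F p) - DF p (incl \<iota> (q - p))) \<le> e * norm (incl \<iota> (q - p))"
    using weak_derivative[OF pD e(1)] by blast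
  obtain d3 where d3: "0 < d3" "\<And>q. q \<in> W \<Longrightarrow> dist q (F p) < d3 \<Longrightarrow>
     \<bar>fst q - fst (F p) - \<alpha> (\<iota> (snd q - snd (F p)))\<bar> \<le> c * w * norm (\<iota> (snd q - snd (F p)))"
    using t Fp unfolding tangent_up_to_def \<alpha>_def w_def by blast
  obtain d4 where d4: "0 < d4" "\<And>q. q \<in> W \<Longrightarrow> dist q p < d4 \<Longrightarrow> dist (F q) (F p) < d3"
    using continuous_F_W p d3(1) unfolding continuous_on_iff by blast
  show "\<exists>d>0. \<forall>q\<in>W. dist q p < d \<longrightarrow>
     \<bar>fst q - fst p - covector p (\<iota> (snd q - snd p))\<bar>
       \<le> c / 2 * fst p powr \<kappa> * norm (\<iota> (snd q - snd p))"
  proof (intro exI[of _ "min d1 (min d2 d4)"] conjI ballI impI)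
    fix q assume q: "q \<in> W" "dist q p < min d1 (min d2 d4)"
    define a v where "a = fst q - fst p" and "v = \<iota> (snd q - snd p)"
    define a' v' where "a' = fst (F q) - fst (F p)" and "v' = \<iota> (snd (F q) - snd (F p))"
    define n where "n = norm v"
    define R where "R = (a', v') - DF p (a, v)"
    have n: "0 \<le> n"
      by (simp add: n_def)
    have a: "\<bar>a\<bar> \<le> 2 * x * n"
    proof -
      have "\<bar>a\<bar> \<le> 2 * \<theta> * x * n"
        using d1(2)[of q] q by (simp add: a_def v_def n_def)
      also have "\<dots> = \<theta> * (2 * x * n)"
        by simp
      also have "\<dots> \<le> 2 * x * n"
        using \<theta> w n by (intro mult_left_le_one_le) auto
      finally show ?thesis .
    qed
    have "x \<le> 1"
      unfolding x_def using \<kappa> region_bounds[OF pD] by (intro powr_le1) auto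
    then have "\<bar>a\<bar> \<le> 2 * n"
      using a n mult_right_mono[of x 1 n] by linarith
    then have "norm (a, v) \<le> 3 * n"
      using norm_Pair_le[of a v] by (simp add: n_def)
    then have "e * norm (a, v) \<le> 3 * e * n"
      using mult_left_mono[of "norm (a, v)" "3 * n" e] e(1) by (simp add: mult_ac)
    moreover have "norm R \<le> e * norm (a, v)"
    proof -
      have "incl \<iota> (q - p) = (a, v)" "incl \<iota> (F q) - incl \<iota> (F p) = (a', v')"
        by (simp_all add: a_def v_def a'_def v'_def case_prod_beta \<iota>.diff)
      moreover have "q \<in> D"
        using q invariant_set_subset by blast
      ultimately show ?thesis
        using d2(2)[of q] q(2) by (simp add: R_def)
    qed
    ultimately have R: "norm R \<le> 3 * e * n"
      by linarith
    have Rfs: "\<bar>fst R\<bar> \<le> 3 * e * n" "norm (snd R) \<le> 3 * e * n"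
      using R norm_fst_le[of "fst R" "snd R"] norm_snd_le[of "snd R" "fst R"] by auto
    have "v' = snd (DF p (a, v)) + snd R"
      by (simp add: R_def)
    then have "norm v' \<le> norm (snd (DF p (a, v))) + norm (snd R)"
      by (simp add: norm_triangle_ineq)
    also have "\<dots> \<le> K * (\<bar>a\<bar> / w + n) + 3 * e * n"
      using derivative_bounds(3)[OF pD, of a v] Rfs by (intro add_mono) (auto simp: w_def n_def)
    \<comment> \<open>Multiplication by \<open>w\<close> removes the singular factor
      \<open>1 / w\<close> from the horizontal increment of the image.\<close>
    finally have "w * norm v' \<le> w * (K * (\<bar>a\<bar> / w + n) + 3 * e * n)"
      using w by (intro mult_left_mono) auto
    also have "\<dots> = K * (\<bar>a\<bar> + w * n) + w * (3 * e * n)"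
      using w by (simp add: field_simps)
    also have "\<dots> \<le> K * (2 * x * n + x * n) + 3 * e * n"
    proof (rule add_mono)
      show "K * (\<bar>a\<bar> + w * n) \<le> K * (2 * x * n + x * n)"
        using a w n K_ge by (intro mult_left_mono add_mono mult_right_mono) auto
      show "w * (3 * e * n) \<le> 3 * e * n"
        using w n e by (intro mult_left_le_one_le) auto
    qed
    finally have "c * (w * norm v') \<le> c * (K * (2 * x * n + x * n) + 3 * e * n)"
      using c by (intro mult_left_mono) auto
    moreover have "\<bar>a' - \<alpha> v'\<bar> \<le> c * (w * norm v')"
      using d3(2)[of "F q"] d4(2)[of q] q invariant_set_F by (simp add: a'_def v'_def mult.assoc)
    moreover have "\<bar>\<alpha> (snd R)\<bar> \<le> 3 * e * n"
    proof -
      have "\<bar>\<alpha> (snd R)\<bar> \<le> norm \<alpha> * norm (snd R)"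
        using norm_blinfun[of \<alpha> "snd R"] by simp
      also have "\<dots> \<le> norm (snd R)"
        using n\<alpha> by (intro mult_left_le_one_le) auto
      finally show ?thesis
        using Rfs by linarith
    qed
    moreover have "pull (DF p) \<alpha> (a, v) = (a' - \<alpha> v') - fst R + \<alpha> (snd R)"
      by (simp add: pull_apply R_def blinfun.diff_right)
    ultimately have "\<bar>pull (DF p) \<alpha> (a, v)\<bar> \<le> c * (K * (2 * x * n + x * n) + 3 * e * n) + 3 * e * n + 3 * e * n"
      using Rfs(1) by linarith
    also have "\<dots> = 3 * c * K * x * n + (e * (3 * c + 6)) * n"
      by (simp add: algebra_simps)
    also have "\<dots> = (4 * c * x * n) * K"
      unfolding e(2) by (simp add: algebra_simps)
    finally have "\<bar>a - transform (DF p) \<alpha> v\<bar> \<le> 4 * c * x * n / 8"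
      by (rule transform_estimate(2)[OF pD \<alpha>(1)])
    then show "\<bar>fst q - fst p - covector p (\<iota> (snd q - snd p))\<bar>
       \<le> c / 2 * fst p powr \<kappa> * norm (\<iota> (snd q - snd p))"
      unfolding \<alpha>(2) by (simp add: a_def v_def n_def x_def)
  qed (use d1 d2 d4 in simp)
qed

lemma C1_\<omega>: "C1_on V \<omega>"
  unfolding C1_on_def
proof (intro exI conjI ballI)
  let ?w = "\<lambda>b. covector (\<omega> b, b) o\<^sub>L Blinfun \<iota>"
  have \<iota>: "blinfun_apply (Blinfun \<iota>) = \<iota>"
    by (rule bounded_linear_Blinfun_apply[OF bounded_linear_\<iota>])
  have "continuous_on V (\<lambda>b. covector (\<omega> b, b))"
    by (rule continuous_on_compose2[OF continuous_covector])
      (auto simp: invariant_set_iff intro!: continuous_intros continuous_\<omega>)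
  then show "continuous_on V ?w"
    by (intro continuous_intros)
  fix b assume b: "b \<in> V"
  show "(\<omega> has_derivative ?w b) (at b)"
    unfolding has_derivative_at_alt
  proof (intro conjI allI impI blinfun.bounded_linear_right)
    fix e :: real assume e: "0 < e"
    define p where "p = (\<omega> b, b)"
    have p: "p \<in> W"
      using b by (simp add: p_def invariant_set_iff)
    obtain n where n: "(1 / 2) ^ n < e / 3"
      using real_arch_pow_inv[of "e / 3" "1 / 2"] e by auto
    \<comment> \<open>The radius in \<open>tangent_up_to\<close> may shrink with every halving, so
      only the finitely many halvings that \<open>e\<close> calls for are made.\<close>
    have "tangent_up_to (3 * (1 / 2) ^ n)"
    proof (induction n)
      case 0
      then show ?case
        using tangent_up_to_3 by simp
    next
      case (Suc n)
      then show ?case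
        using tangent_up_to_half[of "3 * (1 / 2) ^ n"] by simp
    qed
    then obtain d where d: "0 < d" "\<And>q. q \<in> W \<Longrightarrow> dist q p < d \<Longrightarrow>
       \<bar>fst q - fst p - covector p (\<iota> (snd q - snd p))\<bar>
         \<le> 3 * (1 / 2) ^ n * fst p powr \<kappa> * norm (\<iota> (snd q - snd p))"
      using p unfolding tangent_up_to_def by blast
    obtain r where r: "0 < r" "r \<le> d / 2" "ball b r \<subseteq> V" "\<And>c. c \<in> ball b r \<Longrightarrow> \<bar>\<omega> c - \<omega> b\<bar> < d / 2"
      using local_bound[OF continuous_\<omega> b, of "d / 2"] d by auto
    show "\<exists>d>0. \<forall>c. norm (c - b) < d \<longrightarrow> norm (\<omega> c - \<omega> b - ?w b (c - b)) \<le> e * norm (c - b)"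
    proof (intro exI[of _ r] conjI allI impI)
      fix c assume "norm (c - b) < r"
      then have c: "c \<in> ball b r"
        by (simp add: dist_norm norm_minus_commute)
      have "(\<omega> c, c) \<in> W"
        using c r by (auto simp: invariant_set_iff)
      moreover have "dist (\<omega> c, c) p < d"
        using norm_Pair_le[of "\<omega> c - \<omega> b" "c - b"] r(2) r(4)[OF c] \<open>norm (c - b) < r\<close>
        by (simp add: p_def dist_norm)
      ultimately have "\<bar>\<omega> c - \<omega> b - ?w b (c - b)\<bar>
          \<le> 3 * (1 / 2) ^ n * \<omega> b powr \<kappa> * norm (\<iota> (c - b))"
        using d(2)[of "(\<omega> c, c)"] by (simp add: p_def \<iota>)
      \<comment> \<open>The passage from the weak to the strong norm; the weight is at most
        1.\<close>
      also have "\<dots> \<le> e * 1 * norm (c - b)"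
      proof (intro mult_mono)
        show "\<omega> b powr \<kappa> \<le> 1"
          using p invariant_set_bounds[of "\<omega> b" b] \<kappa> by (intro powr_le1) (auto simp: p_def)
      qed (use n e norm_le in auto)
      finally show "norm (\<omega> c - \<omega> b - ?w b (c - b)) \<le> e * norm (c - b)"
        by simp
    qed (use r in simp)
  qed
qed

end

section \<open>Restriction to a subregion and choice of the constants\<close>

lemma jump_out_differentiable_on_subset:
  assumes "jump_out_differentiable_on j V F DF" "V' \<subseteq> V"
  shows "jump_out_differentiable_on j V' F DF"
  using assms unfolding jump_out_differentiable_on_def
  by (blast intro: continuous_on_subset has_derivative_subset)

lemma derivative_form_mono:
  assumes form: "derivative_form E \<kappa> K D F DF Ep" and "D' \<subseteq> D" "K \<le> K'"
  shows "derivative_form E \<kappa> K' D' F DF Ep"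
  unfolding derivative_form_def
proof (intro ballI conjI allI impI)
  fix p assume "p \<in> D'"
  then have "p \<in> D"
    using assms by blast
  then show "1 / E \<le> \<bar>Ep p\<bar>" "\<bar>Ep p\<bar> \<le> E"
    using form by (auto simp: derivative_form_def)
  fix dy db dy' db' assume "blinfun_apply (DF p) (dy, db) = (dy', db')"
  then have *: "\<bar>dy' - Ep p / fst p * dy\<bar> \<le> K * norm db"
    "norm db' \<le> K * (1 / rpower (fst (F p)) \<kappa> * \<bar>dy\<bar> + norm db)"
    using form \<open>p \<in> D\<close> unfolding derivative_form_def by blast+
  have "K * norm db \<le> K' * norm db"
    using assms by (intro mult_right_mono) auto
  with *(1) show "\<bar>dy' - Ep p / fst p * dy\<bar> \<le> K' * norm db"
    by linarith
  have "K * (1 / rpower (fst (F p)) \<kappa> * \<bar>dy\<bar> + norm db)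
      \<le> K' * (1 / rpower (fst (F p)) \<kappa> * \<bar>dy\<bar> + norm db)"
    using assms by (intro mult_right_mono) (auto simp: rpower_def)
  with *(2) show "norm db' \<le> K' * (1 / rpower (fst (F p)) \<kappa> * \<bar>dy\<bar> + norm db)"
    by linarith
qed

text \<open>Where the first coordinate of \<open>F p\<close> vanishes, vertical expansion fails; hence the coordinate keeps
  the positive sign that it has on the lower boundary.\<close>

lemma vertical_expansion_target:
  assumes cont: "continuous_on (region V dm dp) F"
    and hyp: "topologically_hyperbolic dm dp V F"
    and exp: "vertical_expansion \<kappa> \<xi> (region V dm dp) F"
    and order: "\<And>b. b \<in> V \<Longrightarrow> 0 < dm b \<and> dm b < dp b \<and> dp b < 1"
    and "0 < \<kappa>" "1 < \<xi>" and p: "p \<in> region V dm dp"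
  shows "0 < fst (F p)" "fst (F p) powr \<kappa> \<le> fst p"
proof -
  let ?D = "region V dm dp"
  obtain y b where yb: "p = (y, b)"
    by (cases p)
  have b: "b \<in> V" "dm b \<le> y" "y \<le> dp b"
    using p by (auto simp: yb region_def)
  have expand: "\<xi> \<le> fst q / fst (F q) powr \<kappa>" if "q \<in> ?D" for q
    using exp that \<open>0 < \<kappa>\<close> by (simp add: vertical_expansion_def rpower_def)
  have line: "(t, b) \<in> ?D" if "t \<in> {dm b..y}" for t
    using that b order[OF b(1)] by (auto simp: region_def)
  show pos: "0 < fst (F p)"
  proof (rule ccontr)
    assume neg: "\<not> 0 < fst (F p)"
    \<comment> \<open>The lower end of the fibre through \<open>p\<close> is sent on or above the
      graph of \<open>dp\<close>, where heights are positive.\<close>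
    have "snd (F (dm b, b)) \<in> V" "dp (snd (F (dm b, b))) \<le> fst (F (dm b, b))"
      using hyp line[of "dm b"] b unfolding topologically_hyperbolic_def
      by (cases "F (dm b, b)"; force)+
    then have "0 < fst (F (dm b, b))"
      using order by force
    moreover have "continuous_on {dm b..y} (\<lambda>t. fst (F (t, b)))"
      using line by (intro continuous_on_fst continuous_on_compose2[OF cont]) (auto intro!: continuous_intros)
    ultimately obtain t where t: "t \<in> {dm b..y}" "fst (F (t, b)) = 0"
      using IVT2'[of "\<lambda>t. fst (F (t, b))" y 0 "dm b"] neg b by (auto simp: yb)
    \<comment> \<open>At image height 0 the quotient is a division by 0 with value 0, so vertical
      expansion would give \<open>\<xi> \<le> 0\<close>.\<close>
    then show False
      using expand[OF line[OF t(1)]] \<open>0 < \<kappa>\<close> \<open>1 < \<xi>\<close> by simp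
  qed
  have "\<xi> * fst (F p) powr \<kappa> \<le> fst p"
    using expand[OF p] pos by (simp add: pos_le_divide_eq)
  moreover have "1 * fst (F p) powr \<kappa> \<le> \<xi> * fst (F p) powr \<kappa>"
    using \<open>1 < \<xi>\<close> by (intro mult_right_mono) auto
  ultimately show "fst (F p) powr \<kappa> \<le> fst p"
    by simp
qed

theorem theorem2p8:
  fixes \<iota> :: "'b::real_normed_vector \<Rightarrow> 'a::real_normed_vector"
    and E \<kappa> K :: real
  assumes "linear \<iota>" and "inj \<iota>" and "\<forall>b. norm (\<iota> b) \<le> norm b"
    and "E \<noteq> 0" and "0 \<le> \<kappa>" and "\<kappa> < 1"
  shows
    "\<exists>\<theta>0>0. \<forall>\<theta>. 0 < \<theta> \<and> \<theta> < \<theta>0 \<longrightarrow>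
      (\<exists>\<delta>0>0. \<exists>\<eta>0>0. \<exists>\<xi>0>0. \<forall>\<delta> \<eta> \<xi>.
        0 < \<delta> \<and> \<delta> < \<delta>0 \<and> \<delta> < 1/4 \<and> 0 < \<eta> \<and> \<eta> < \<eta>0 \<and> \<xi>0 < \<xi> \<longrightarrow>
        (\<forall>(U :: 'b set) (dm :: 'b \<Rightarrow> real) (dp :: 'b \<Rightarrow> real) (Ud :: real \<Rightarrow> 'b set)
            (F :: real \<times> 'b \<Rightarrow> real \<times> 'b)
            (DF :: real \<times> 'b \<Rightarrow> (real \<times> 'a) \<Rightarrow>\<^sub>L (real \<times> 'a))
            (Ep :: real \<times> 'b \<Rightarrow> real).
          open U \<and>
          almost_vertical \<iota> \<theta> \<kappa> U dm \<and> almost_vertical \<iota> \<theta> \<kappa> U dp \<and>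
          (\<forall>b\<in>U. 1 > dp b \<and> dp b > dm b \<and> dm b > 0) \<and>
          continuous_on (region U dm dp) F \<and>
          jump_out_differentiable_on (\<lambda>(y, b). (y, \<iota> b)) (region U dm dp) F DF \<and>
          derivative_form E \<kappa> K (region U dm dp) F DF Ep \<and>
          (\<forall>d. 0 < d \<and> d < 1/4 \<longrightarrow>
             open (Ud d) \<and> Ud d \<subseteq> U \<and> (\<forall>b\<in>Ud d. dp b < d) \<and>
             topologically_hyperbolic dm dp (Ud d) F) \<and>
          vertical_expansion \<kappa> \<xi> (region (Ud \<delta>) dm dp) F \<and>
          dominating_horizontal_expansion \<kappa> \<eta> (region (Ud \<delta>) dm dp) F
          \<longrightarrow>
          (\<exists>w. invariant_set (region (Ud \<delta>) dm dp) F = graph_over (Ud \<delta>) w \<and>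
               almost_vertical \<iota> \<theta> \<kappa> (Ud \<delta>) w \<and> C1_on (Ud \<delta>) w)))"
proof -
  \<comment> \<open>The statement allows any real \<open>K\<close> and any nonzero \<open>E\<close>;
    hence the maximum here and the absolute value in \<open>bound\<close>.\<close>
  define L where "L = max K 1"
  \<comment> \<open>The height at which \<open>16 * \<bar>E\<bar> * L * y\<close> and
    \<open>\<theta> * y powr \<kappa>\<close> are equal; below it the latter is larger because
    \<open>\<kappa> < 1\<close>.\<close>
  define bound where "bound \<theta> = (\<theta> / (16 * \<bar>E\<bar> * L)) powr (1 / (1 - \<kappa>))" for \<theta>
  have L: "1 \<le> L" "K \<le> L"
    by (auto simp: L_def)
  have bound_pos: "0 < bound \<theta>" if "0 < \<theta>" for \<theta>
    using that L assms(4) by (auto simp: bound_def)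
  have small: "16 * \<bar>E\<bar> * L * y \<le> \<theta> * y powr \<kappa>" if y: "0 < y" "y < bound \<theta>" and "0 < \<theta>" for y \<theta>
  proof -
    have pos: "0 < 16 * \<bar>E\<bar> * L"
      using L assms(4) by auto
    have "y powr (1 - \<kappa>) \<le> bound \<theta> powr (1 - \<kappa>)"
      using y assms(6) by (intro powr_mono2) auto
    also have "\<dots> = \<theta> / (16 * \<bar>E\<bar> * L)"
      using pos assms(6) \<open>0 < \<theta>\<close> by (simp add: bound_def powr_powr)
    finally have "16 * \<bar>E\<bar> * L * y powr (1 - \<kappa>) \<le> \<theta>"
      using pos by (simp add: pos_le_divide_eq mult_ac)
    then have "16 * \<bar>E\<bar> * L * y powr (1 - \<kappa>) * y powr \<kappa> \<le> \<theta> * y powr \<kappa>"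
      by (rule mult_right_mono) simp
    moreover have "y powr (1 - \<kappa>) * y powr \<kappa> = y"
      using y by (simp flip: powr_add)
    ultimately show ?thesis
      by (simp add: mult.assoc)
  qed
  have main: "\<exists>w. invariant_set (region V dm dp) F = graph_over V w \<and>
      almost_vertical \<iota> \<theta> \<kappa> V w \<and> C1_on V w"
    if \<theta>: "0 < \<theta>" "\<theta> < 1" and \<delta>: "\<delta> < bound \<theta>" and \<xi>: "1 < \<xi>"
      and V: "open V" "V \<subseteq> U" "\<forall>b\<in>V. dp b < \<delta>"
      and vertical: "almost_vertical \<iota> \<theta> \<kappa> U dm" "almost_vertical \<iota> \<theta> \<kappa> U dp"
      and order: "\<forall>b\<in>U. 1 > dp b \<and> dp b > dm b \<and> dm b > 0"
      and F: "continuous_on (region U dm dp) F"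
        "jump_out_differentiable_on (incl \<iota>) (region U dm dp) F DF"
        "derivative_form E \<kappa> K (region U dm dp) F DF Ep"
      and hyp: "topologically_hyperbolic dm dp V F"
      and exp: "vertical_expansion \<kappa> \<xi> (region V dm dp) F"
    for \<theta> \<delta> \<xi> :: real and U V :: "'b set" and dm dp F Ep
      and DF :: "real \<times> 'b \<Rightarrow> (real \<times> 'a) \<Rightarrow>\<^sub>L (real \<times> 'a)"
  proof (cases "V = {}")
    case True
    then show ?thesis
      by (auto simp: invariant_set_def region_def graph_over_def almost_vertical_def C1_on_def)
  next
    case False
    then obtain b where b: "b \<in> V"
      by blast
    have order': "0 < dm b \<and> dm b < dp b \<and> dp b < 1" if "b \<in> V" for b
      using order V that by auto
    have sub: "region V dm dp \<subseteq> region U dm dp"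
      using V by (auto simp: region_def)
    \<comment> \<open>The signs of \<open>E\<close> and \<kappa> are read off at a point of the
      region, which is why the empty case is separate.\<close>
    have pt: "(dm b, b) \<in> region V dm dp"
      using b order' by (force simp: region_def)
    have "\<bar>Ep (dm b, b)\<bar> \<le> E"
      using F(3) pt sub unfolding derivative_form_def by blast
    then have E: "0 < E"
      using assms(4) by linarith
    \<comment> \<open>For \<open>\<kappa> = 0\<close> the denominator is 1, and the height
      \<open>dm b < 1\<close> would be at least \<open>\<xi> > 1\<close>.\<close>
    have "\<xi> \<le> dm b / rpower (fst (F (dm b, b))) \<kappa>"
      using exp pt by (auto simp: vertical_expansion_def)
    then have "\<kappa> \<noteq> 0"
      using order'[OF b] \<xi> by (auto simp: rpower_def)
    then have \<kappa>: "0 < \<kappa>" "\<kappa> < 1"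
      using assms by auto
    interpret expanding_region \<iota> E \<kappa> L \<theta> V dm dp F DF Ep
    proof (rule expanding_region.intro)
      show "linear \<iota>"
        by (rule assms)
      show "norm (\<iota> b) \<le> norm b" for b
        using assms by auto
      show "almost_vertical \<iota> \<theta> \<kappa> V dm" "almost_vertical \<iota> \<theta> \<kappa> V dp"
        using vertical V almost_vertical_subset by blast+
      show "continuous_on (region V dm dp) F"
        using F(1) sub continuous_on_subset by blast
      then show "0 < fst (F p) \<and> fst (F p) powr \<kappa> \<le> fst p" if "p \<in> region V dm dp" for p
        using vertical_expansion_target[OF _ hyp exp order' \<kappa>(1) \<xi> that] by blast
      show "jump_out_differentiable_on (incl \<iota>) (region V dm dp) F DF"
        using F(2) sub by (rule jump_out_differentiable_on_subset)
      show "derivative_form E \<kappa> L (region V dm dp) F DF Ep"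
        using F(3) sub L(2) by (rule derivative_form_mono)
      show "16 * E * L * fst p \<le> \<theta> * fst p powr \<kappa>" if p: "p \<in> region V dm dp" for p
      proof -
        have "snd p \<in> V" "dm (snd p) \<le> fst p" "fst p \<le> dp (snd p)"
          using p by (auto simp: region_def)
        then have "0 < fst p" "fst p < bound \<theta>"
          using order' V(3) \<delta> by force+
        then show ?thesis
          using small[of "fst p" \<theta>] \<theta> E by simp
      qed
    qed (use E L \<kappa> \<theta> V order' hyp in auto)
    show ?thesis
      using invariant_set_graph almost_vertical_\<omega> C1_\<omega> by blast
  qed
  show ?thesis
  proof (rule exI[of _ 1], rule conjI[OF zero_less_one], intro allI impI, elim conjE, goal_cases)
    case \<theta>: (1 \<theta>)
    show ?case
    \<comment> \<open>The threshold for \<delta> is tied to \<theta> by \<open>small\<close>;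
      \<open>\<theta> < 1\<close> serves the Lipschitz constants and \<open>\<xi> > 1\<close> serves
      \<open>target\<close>.\<close>
    proof (rule exI[of _ "bound \<theta>"], rule conjI[OF bound_pos[OF \<theta>(1)]],
        rule exI[of _ 1], rule conjI[OF zero_less_one], rule exI[of _ 1], rule conjI[OF zero_less_one],
        intro allI impI, elim conjE, goal_cases)
      case (1 \<delta> \<eta> \<xi> U dm dp Ud F DF Ep)
      then show ?case
        using main[OF \<theta>, of \<delta> \<xi> "Ud \<delta>" U dp dm F DF Ep] by simp
    qed
  qed
qed

end
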